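(* Let $n\in\mathbb{N}$ and let $p,q_0\in\mathcal{P}(\mathbb{R}^n)$ with $p^+<\infty$. Let $0<q\le\infty$ and $0<\theta<1$, and define $\tilde p(\cdot)$ by $$\frac{1}{\tilde p(\cdot)}=\frac{1-\theta}{p(\cdot)}.$$ Then $$\big(L_{p(\cdot),q_0(\cdot)}(\mathbb{R}^n),L_\infty(\mathbb{R}^n)\big)_{\theta,q}=L_{\tilde p(\cdot),q}(\mathbb{R}^n)$$ in the sense of equivalent quasi-norms.
   Context: Functions are identified when they agree almost everywhere. "In the sense of equivalent quasi-norms" means that both spaces consist of the same functions and each quasi-norm is bounded by a constant (independent of the function) times the other. $\mathcal{P}(\mathbb{R}^n)$ is the class of all measurable functions $p:\mathbb{R}^n\to(0,\infty]$ with $p^-:=\operatorname{ess\,inf}_{x\in\mathbb{R}^n}p(x)>0$; $p^+:=\operatorname{ess\,sup}_{x\in\mathbb{R}^n}p(x)$. For $t\ge 0$ put $\varphi_p(t)=t^p$ if $p\in(0,\infty)$; $\varphi_\infty(t)=0$ if $t\le1$ and $\varphi_\infty(t)=\infty$ if $t>1$. For $p\in\mathcal{P}(\mathbb{R}^n)$ and measurable $f$ let $\varrho_{p(\cdot)}(f)=\int_{\mathbb{R}^n}\varphi_{p(x)}(|f(x)|)\,dx$ and $\|f|L_{p(\cdot)}(\mathbb{R}^n)\|=\inf\{\lambda>0:\varrho_{p(\cdot)}(f/\lambda)\le1\}$ (with $\inf\emptyset=\infty$). Variable second exponent: for a sequence $(f_k)_{k\in\mathbb{Z}}$ of measurable functions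 and $p,q_0\in\mathcal{P}(\mathbb{R}^n)$ let $$\varrho_{\ell_{q_0(\cdot)}(L_{p(\cdot)})}\big((f_k)_k\big)=\sum_{k\in\mathbb{Z}}\inf\Big\{\lambda_k>0:\varrho_{p(\cdot)}\Big(\frac{f_k}{\lambda_k^{1/q_0(\cdot)}}\Big)\le1\Big\},$$ with the conventions $\lambda^{1/\infty}=1$ and $\inf\emptyset=\infty$. $L_{p(\cdot),q_0(\cdot)}(\mathbb{R}^n)$ is the collection of all measurable $f:\mathbb{R}^n\to\mathbb{C}$ with $$\|f|L_{p(\cdot),q_0(\cdot)}(\mathbb{R}^n)\|=\inf\Big\{\lambda>0:\varrho_{\ell_{q_0(\cdot)}(L_{p(\cdot)})}\Big(\big(2^k\chi_{\{x\in\mathbb{R}^n:|f(x)/\lambda|>2^k\}}\big)_{k\in\mathbb{Z}}\Big)\le1\Big\}<\infty,$$ where $\chi_A$ is the characteristic function of $A$. Constant second exponent: for $p\in\mathcal{P}(\mathbb{R}^n)$ and a constant $0<q\le\infty$, $L_{p(\cdot),q}(\mathbb{R}^n)$ is the collection of all measurable $f:\mathbb{R}^n\to\mathbb{C}$ such that $\|f|L_{p(\cdot),q}(\mathbb{R}^n)\|<\infty$, where $$\|f|L_{p(\cdot),q}(\mathbb{R}^n)\|=\Big(\int_0^\infty\lambda^q\|\chi_{\{x\in\mathbb{R}^n:|f(x)|>\lambda\}}|L_{p(\cdot)}(\mathbb{R}^n)\|^q\frac{d\lambda}{\lambda}\Big)^{1/q}\quad(q<\infty),$$ $$\|f|L_{p(\cdot),\infty}(\mathbb{R}^n)\|=\sup_{\lambda>0}\lambda\|\chi_{\{x\in\mathbb{R}^n:|f(x)|>\lambda\}}|L_{p(\cdot)}(\mathbb{R}^n)\|\quad(q=\infty).$$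 (For constant second exponent the two definitions give the same space up to equivalent quasi-norms.) Real interpolation (K-method): for quasi-Banach spaces $X_0,X_1$ embedded into a common topological vector space (here, measurable functions), $X_0+X_1$ is the set of all $x=x_0+x_1$ with $x_i\in X_i$, and for $x\in X_0+X_1$, $t>0$, $$K(x,t)=\inf\{\|x_0|X_0\|+t\|x_1|X_1\|:x=x_0+x_1,\ x_0\in X_0,\ x_1\in X_1\}.$$ For $0<\theta<1$, $0<q\le\infty$, $(X_0,X_1)_{\theta,q}$ is the set of $x\in X_0+X_1$ with finite quasi-norm $\|x|(X_0,X_1)_{\theta,q}\|=\big(\int_0^\infty t^{-\theta q}K(x,t)^q\frac{dt}{t}\big)^{1/q}$ if $q<\infty$, and $\sup_{t>0}t^{-\theta}K(x,t)$ if $q=\infty$. *)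

theory Defs
  imports "HOL-Analysis.Analysis" "HOL-Probability.Essential_Supremum"
begin

text \<open>
  Exponents and quasi-norms take values in \<^typ>\<open>ennreal\<close>, and the infimum of the empty set
  there is \<open>\<infinity>\<close>. ``Measurable'' on the Euclidean space means Lebesgue measurable. Spaces are
  sets of functions rather than sets of equivalence classes; every identity between elements
  of such a space is read almost everywhere.
\<close>

definition essinf :: "'a measure \<Rightarrow> ('a \<Rightarrow> ennreal) \<Rightarrow> ennreal" where
  "essinf M f = Sup {z. AE x in M. z \<le> f x}"

definition exponents :: "(real ^ 'n \<Rightarrow> ennreal) set" where
  "exponents = {p \<in> borel_measurable lebesgue. (\<forall>x. 0 < p x) \<and> 0 < essinf lebesgue p}"

text \<open>Powers with a real exponent \<open>r > 0\<close>; the value at a finite base is the real \<open>powr\<close>.\<close>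

definition enn_powr :: "ennreal \<Rightarrow> real \<Rightarrow> ennreal" where
  "enn_powr x r = (if x = \<infinity> then \<infinity> else ennreal (enn2real x powr r))"

definition phi :: "ennreal \<Rightarrow> real \<Rightarrow> ennreal" where
  "phi p t = (if p = \<infinity> then (if t \<le> 1 then 0 else \<infinity>) else ennreal (t powr enn2real p))"

definition modular :: "(real ^ 'n \<Rightarrow> ennreal) \<Rightarrow> (real ^ 'n \<Rightarrow> 'b::real_normed_vector) \<Rightarrow> ennreal" where
  "modular p f = (\<integral>\<^sup>+ x. phi (p x) (norm (f x)) \<partial>lebesgue)"

definition Lp_norm :: "(real ^ 'n \<Rightarrow> ennreal) \<Rightarrow> (real ^ 'n \<Rightarrow> 'b::real_normed_vector) \<Rightarrow> ennreal" where
  "Lp_norm p f = Inf {ennreal \<mu> | \<mu>. 0 < \<mu> \<and> modular p (\<lambda>x. f x /\<^sub>R \<mu>) \<le> 1}"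

text \<open>\<open>root_exp \<mu> s\<close> is \<open>\<mu>\<close> to the power \<open>1 / s\<close>, for \<open>\<mu> > 0\<close> and \<open>0 < s \<le> \<infinity>\<close>.\<close>

definition root_exp :: "real \<Rightarrow> ennreal \<Rightarrow> real" where
  "root_exp \<mu> s = (if s = \<infinity> then 1 else \<mu> powr (1 / enn2real s))"

definition mixed_modular ::
  "(real ^ 'n \<Rightarrow> ennreal) \<Rightarrow> (real ^ 'n \<Rightarrow> ennreal) \<Rightarrow>
   (int \<Rightarrow> real ^ 'n \<Rightarrow> 'b::real_normed_vector) \<Rightarrow> ennreal" where
  "mixed_modular q p f =
     (\<Sum>\<^sub>\<infinity>k. Inf {ennreal \<mu> | \<mu>. 0 < \<mu> \<and> modular p (\<lambda>x. f k x /\<^sub>R root_exp \<mu> (q x)) \<le> 1})"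

text \<open>A function space is its underlying set together with its quasi-norm.\<close>

type_synonym 'n fspace =
  "(real ^ 'n \<Rightarrow> complex) set \<times> ((real ^ 'n \<Rightarrow> complex) \<Rightarrow> ennreal)"

definition space_of_norm :: "((real ^ 'n \<Rightarrow> complex) \<Rightarrow> ennreal) \<Rightarrow> 'n fspace" where
  "space_of_norm N = ({f \<in> borel_measurable lebesgue. N f < \<infinity>}, N)"

definition var_lorentz_norm ::
  "(real ^ 'n \<Rightarrow> ennreal) \<Rightarrow> (real ^ 'n \<Rightarrow> ennreal) \<Rightarrow> (real ^ 'n \<Rightarrow> complex) \<Rightarrow> ennreal" where
  "var_lorentz_norm p q f =
     Inf {ennreal \<mu> | \<mu>. 0 < \<mu> \<and>
       mixed_modular q p
         (\<lambda>k x. 2 powi k * (indicator {y. norm (f y / of_real \<mu>) > 2 powi k} x :: real)) \<le> 1}"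

definition var_lorentz :: "(real ^ 'n \<Rightarrow> ennreal) \<Rightarrow> (real ^ 'n \<Rightarrow> ennreal) \<Rightarrow> 'n fspace" where
  "var_lorentz p q = space_of_norm (var_lorentz_norm p q)"

definition superlevel_norm ::
  "(real ^ 'n \<Rightarrow> ennreal) \<Rightarrow> (real ^ 'n \<Rightarrow> complex) \<Rightarrow> real \<Rightarrow> ennreal" where
  "superlevel_norm p f \<mu> = Lp_norm p (indicator {x. norm (f x) > \<mu>} :: real ^ 'n \<Rightarrow> real)"

definition lorentz_norm ::
  "(real ^ 'n \<Rightarrow> ennreal) \<Rightarrow> ennreal \<Rightarrow> (real ^ 'n \<Rightarrow> complex) \<Rightarrow> ennreal" where
  "lorentz_norm p q f =
     (if q = \<infinity> then (SUP \<mu>\<in>{0<..}. ennreal \<mu> * superlevel_norm p f \<mu>)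
      else enn_powr
        (\<integral>\<^sup>+ \<mu>\<in>{0<..}. ennreal (\<mu> powr enn2real q) * enn_powr (superlevel_norm p f \<mu>) (enn2real q)
            * ennreal (1 / \<mu>) \<partial>lborel)
        (1 / enn2real q))"

definition lorentz :: "(real ^ 'n \<Rightarrow> ennreal) \<Rightarrow> ennreal \<Rightarrow> 'n fspace" where
  "lorentz p q = space_of_norm (lorentz_norm p q)"

definition L_infty :: "'n::finite fspace" where
  "L_infty = space_of_norm (\<lambda>f. esssup lebesgue (\<lambda>x. ennreal (norm (f x))))"

definition sum_space :: "'n::finite fspace \<Rightarrow> 'n fspace \<Rightarrow> (real ^ 'n \<Rightarrow> complex) set" where
  "sum_space X0 X1 = {f \<in> borel_measurable lebesgue.
     \<exists>g\<in>fst X0. \<exists>h\<in>fst X1. AE x in lebesgue. f x = g x + h x}"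

definition K_functional ::
  "'n::finite fspace \<Rightarrow> 'n fspace \<Rightarrow> (real ^ 'n \<Rightarrow> complex) \<Rightarrow> real \<Rightarrow> ennreal" where
  "K_functional X0 X1 f t = Inf {snd X0 g + ennreal t * snd X1 h | g h.
     g \<in> fst X0 \<and> h \<in> fst X1 \<and> (AE x in lebesgue. f x = g x + h x)}"

definition interp_norm ::
  "'n::finite fspace \<Rightarrow> 'n fspace \<Rightarrow> real \<Rightarrow> ennreal \<Rightarrow> (real ^ 'n \<Rightarrow> complex) \<Rightarrow> ennreal" where
  "interp_norm X0 X1 \<theta> q f =
     (if q = \<infinity> then (SUP t\<in>{0<..}. ennreal (t powr (- \<theta>)) * K_functional X0 X1 f t)
      else enn_powr
        (\<integral>\<^sup>+ t\<in>{0<..}. ennreal (t powr (- \<theta> * enn2real q))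
            * enn_powr (K_functional X0 X1 f t) (enn2real q) * ennreal (1 / t) \<partial>lborel)
        (1 / enn2real q))"

definition real_interpolation ::
  "'n::finite fspace \<Rightarrow> 'n fspace \<Rightarrow> real \<Rightarrow> ennreal \<Rightarrow> 'n fspace" where
  "real_interpolation X0 X1 \<theta> q =
     ({f \<in> sum_space X0 X1. interp_norm X0 X1 \<theta> q f < \<infinity>}, interp_norm X0 X1 \<theta> q)"

definition equal_equiv_norms :: "'n::finite fspace \<Rightarrow> 'n fspace \<Rightarrow> bool" where
  "equal_equiv_norms X Y \<longleftrightarrow> fst X = fst Y \<and>
     (\<exists>C>0. \<forall>f\<in>fst X. snd X f \<le> ennreal C * snd Y f \<and> snd Y f \<le> ennreal C * snd X f)"

end

theory Submission
  imports Defs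
begin

text \<open>
  Write \<open>D(s)\<close> for the \<open>L\<^sub>p\<close>-norm of the indicator function of \<open>{\<bar>f\<bar> > s}\<close>. For indicator
  functions the change of exponent from \<open>p\<close> to \<open>p / (1 - \<theta>)\<close> just raises the norm to the power
  \<open>1 - \<theta>\<close> (\<open>Lp_norm_indicator_dilate\<close>). Hence the Lorentz norm on the right is the
  \<open>L\<^sub>q(ds/s)\<close>-norm of \<open>s D(s)\<^bsup>1 - \<theta>\<^esup>\<close>, while the interpolation norm is the \<open>L\<^sub>q(dt/t)\<close>-norm of
  \<open>t\<^bsup>-\<theta>\<^esup> K(t)\<close>, where \<open>K(t)\<close> is the K-functional of \<open>f\<close>. It remains to compare \<open>K\<close> with \<open>D\<close>.

  The variable exponent \<open>q\<^sub>0\<close> enters only through a positive number \<open>r\<close> with \<open>r \<le> q\<^sub>0\<close> almost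
  everywhere. It yields that \<open>L\<^bsub>p,q\<^sub>0\<^esub>\<close> lies between \<open>L\<^bsub>p,r\<^esub>\<close> and the weak space
  \<open>L\<^bsub>p,\<infinity>\<^esub>\<close>, and these two embeddings give pointwise bounds for \<open>K\<close>:

  \<^item> If \<open>t \<le> D(s)\<close>, then \<open>K(t)\<close> is at least of order \<open>s t\<close> (\<open>K_functional_lower_bound\<close>), for
    in \<open>f = g + h\<close> either \<open>h\<close> is large in \<open>L\<^sub>\<infinity>\<close> or \<open>g\<close> is large on \<open>{\<bar>f\<bar> > s}\<close>.

  \<^item> For \<open>0 < \<epsilon> < 1\<close>, \<open>K(t)\<close> is at most of order \<open>t\<^bsup>\<epsilon>\<^esup>\<close> times the supremum over \<open>s\<close> of
    \<open>s min(D(s), t)\<^bsup>1 - \<epsilon>\<^esup>\<close> (\<open>K_functional_upper_bound\<close>). Here \<open>f\<close> is cut at the height where this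
    supremum forces \<open>D\<close> below \<open>t\<close>; above it, \<open>D\<close> decays faster than \<open>1 / s\<close>, so that the dyadic
    series defining the quasi-norm is geometric.

  Integrating these bounds is a matter of exchanging integrals in one real variable each. The first
  turns into an estimate of the Lorentz norm by the interpolation norm
  (\<open>Lq_star_le_of_lower_bound\<close>), the second, with \<open>\<epsilon> < \<theta>\<close>, into the converse
  (\<open>Lq_star_le_of_upper_bound\<close>). The use of a supremum in the second bound makes the argument
  independent of the relation between \<open>q\<close> and \<open>r\<close>.
\<close>

section \<open>Powers of extended nonnegative numbers and preliminaries\<close>

lemma summable_on_ennreal_any: "(f :: 'a \<Rightarrow> ennreal) summable_on A"
  by (rule nonneg_summable_on_complete) simp

text \<open>
  Multiplication is not continuous on \<^typ>\<open>ennreal\<close>, so the general rule for infinite sums in a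
  topological semiring does not apply; suprema of finite sums do commute with constant factors.
\<close>
lemma infsum_cmult_ennreal:
  fixes f :: "'a \<Rightarrow> ennreal"
  shows "(\<Sum>\<^sub>\<infinity>k\<in>A. c * f k) = c * infsum f A"
proof -
  have "(\<Sum>\<^sub>\<infinity>k\<in>A. c * f k) = (SUP F\<in>{F. finite F \<and> F \<subseteq> A}. c * sum f F)"
    by (subst nonneg_infsum_complete) (simp_all only: zero_le sum_distrib_left)
  also have "\<dots> = c * infsum f A"
    by (subst nonneg_infsum_complete) (simp_all only: zero_le SUP_mult_left_ennreal)
  finally show ?thesis .
qed

lemma enn_powr_ennreal: "0 \<le> x \<Longrightarrow> enn_powr (ennreal x) r = ennreal (x powr r)"
  by (simp add: enn_powr_def)

lemma enn_powr_0 [simp]: "enn_powr 0 r = 0"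
  by (simp add: enn_powr_def)

lemma enn_powr_top [simp]: "enn_powr top r = top"
  by (simp add: enn_powr_def)

lemma enn_powr_one [simp]: "enn_powr x 1 = x"
  by (cases x) (simp_all add: enn_powr_def)

lemma enn_powr_mono: "x \<le> y \<Longrightarrow> 0 \<le> r \<Longrightarrow> enn_powr x r \<le> enn_powr y r"
  by (cases x; cases y) (auto simp: enn_powr_def top_unique intro!: ennreal_leI powr_mono2)

lemma enn_powr_powr: "enn_powr (enn_powr x a) b = enn_powr x (a * b)"
  by (cases x) (simp_all add: enn_powr_def powr_powr)

lemma enn_powr_mult: "enn_powr (x * y) r = enn_powr x r * enn_powr y r"
proof (cases "x = top \<or> y = top")
  case True
  then show ?thesis
    by (cases x; cases y) (auto simp: enn_powr_def ennreal_mult_top ennreal_top_mult)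
next
  case False
  then obtain a b where "0 \<le> a" "x = ennreal a" "0 \<le> b" "y = ennreal b"
    by (metis ennreal_cases infinity_ennreal_def)
  then show ?thesis
    by (simp add: enn_powr_ennreal powr_mult flip: ennreal_mult)
qed

lemma enn_powr_le_iff:
  assumes "0 < r" shows "enn_powr x r \<le> y \<longleftrightarrow> x \<le> enn_powr y (1 / r)"
proof
  assume "enn_powr x r \<le> y"
  then have "enn_powr (enn_powr x r) (1 / r) \<le> enn_powr y (1 / r)"
    using assms by (intro enn_powr_mono) auto
  then show "x \<le> enn_powr y (1 / r)" using assms by (simp add: enn_powr_powr)
next
  assume "x \<le> enn_powr y (1 / r)"
  then have "enn_powr x r \<le> enn_powr (enn_powr y (1 / r)) r"
    using assms by (intro enn_powr_mono) auto
  then show "enn_powr x r \<le> y" using assms by (simp add: enn_powr_powr)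
qed

lemma measurable_enn_powr [measurable (raw)]:
  assumes [measurable]: "f \<in> borel_measurable M"
  shows "(\<lambda>x. enn_powr (f x) r) \<in> borel_measurable M"
  unfolding enn_powr_def infinity_ennreal_def by measurable

lemma borel_measurable_antimono_ennreal:
  fixes D :: "real \<Rightarrow> ennreal"
  assumes "antimono D" shows "D \<in> borel_measurable borel"
proof (rule borel_measurableI_greater)
  fix y
  have "is_interval {x. y < D x}"
    using assms unfolding is_interval_1 antimono_def by (auto intro: less_le_trans)
  then have "{x. y < D x} \<in> sets borel"
    by (rule real_interval_borel_measurable)
  then show "{x \<in> space borel. y < D x} \<in> sets borel" by simp
qed

lemma borel_measurable_mono_ennreal:
  fixes K :: "real \<Rightarrow> ennreal"
  assumes "mono K" shows "K \<in> borel_measurable borel"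
proof (rule borel_measurableI_greater)
  fix y
  have "is_interval {x. y < K x}"
    using assms unfolding is_interval_1 mono_def by (auto intro: less_le_trans)
  then have "{x. y < K x} \<in> sets borel"
    by (rule real_interval_borel_measurable)
  then show "{x \<in> space borel. y < K x} \<in> sets borel" by simp
qed

section \<open>The space \<open>L\<^sub>q(ds/s)\<close> on the half-line\<close>

text \<open>
  The quasi-norm of the multiplication-invariant space \<open>L\<^sub>q((0,\<infinity>), ds/s)\<close>. Both quasi-norms in
  the theorem have this form, so that they are compared by comparing functions of one variable.
\<close>

definition Lq_star :: "ennreal \<Rightarrow> (real \<Rightarrow> ennreal) \<Rightarrow> ennreal" where
  "Lq_star q F =
     (if q = \<infinity> then (SUP s\<in>{0<..}. F s)
      else enn_powr (\<integral>\<^sup>+ s\<in>{0<..}. enn_powr (F s) (enn2real q) * ennreal (1 / s) \<partial>lborel)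
             (1 / enn2real q))"

lemma Lq_star_cmult:
  assumes [measurable]: "F \<in> borel_measurable borel" and "0 \<le> c" "0 < q"
  shows "Lq_star q (\<lambda>s. ennreal c * F s) = ennreal c * Lq_star q F"
proof (cases "q = \<infinity>")
  case True
  then show ?thesis by (simp add: Lq_star_def SUP_mult_left_ennreal)
next
  case False
  define Q where "Q = enn2real q"
  have "Q > 0" using False assms(3) by (simp add: Q_def enn2real_positive_iff less_top)
  have "(\<integral>\<^sup>+ s\<in>{0<..}. enn_powr (ennreal c * F s) Q * ennreal (1 / s) \<partial>lborel)
      = (\<integral>\<^sup>+ s. enn_powr (ennreal c) Q * (enn_powr (F s) Q * ennreal (1 / s) * indicator {0<..} s) \<partial>lborel)"
    by (simp add: enn_powr_mult mult_ac)
  also have "\<dots> = enn_powr (ennreal c) Q * (\<integral>\<^sup>+ s\<in>{0<..}. enn_powr (F s) Q * ennreal (1 / s) \<partial>lborel)"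
    by (intro nn_integral_cmult) measurable
  finally show ?thesis
    unfolding Lq_star_def if_not_P[OF False] Q_def[symmetric]
    using \<open>Q > 0\<close> by (simp add: enn_powr_mult enn_powr_powr)
qed

lemma Lq_star_finite_imp_ex_finite:
  assumes "Lq_star q F < \<infinity>" "0 < q"
  shows "\<exists>t>0. F t < \<infinity>"
proof (rule ccontr)
  assume "\<not> (\<exists>t>0. F t < \<infinity>)"
  then have F: "F t = top" if "0 < t" for t using that by (metis infinity_ennreal_def top.not_eq_extremum)
  show False
  proof (cases "q = \<infinity>")
    case True
    have "F 1 \<le> Lq_star q F" using True by (auto simp: Lq_star_def intro!: SUP_upper)
    then show False using assms F[of 1] by (simp add: top_unique)
  next
    case False
    have "top = top * emeasure lborel {0<..1::real}" by (simp add: ennreal_top_mult)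
    also have "\<dots> = (\<integral>\<^sup>+ t. top * indicator {0<..1::real} t \<partial>lborel)"
      by (subst nn_integral_cmult_indicator) auto
    also have "\<dots> \<le> (\<integral>\<^sup>+ t\<in>{0<..}. enn_powr (F t) (enn2real q) * ennreal (1 / t) \<partial>lborel)"
      by (intro nn_integral_mono) (auto simp: F ennreal_top_mult split: split_indicator)
    finally show False
      using assms False by (simp add: Lq_star_def top_unique)
  qed
qed

lemma nn_integral_powr_upto:
  assumes "0 < a"
  shows "(\<integral>\<^sup>+ t\<in>{0<..}. ennreal (t powr (a - 1)) * indicator {t. ennreal t \<le> d} t \<partial>lborel)
         = ennreal (1 / a) * enn_powr d a" (is "?I d = _")
proof -
  have finite: "?I (ennreal c) = ennreal (c powr a / a)" if "0 \<le> c" for c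
  proof -
    have "?I (ennreal c) = (\<integral>\<^sup>+ t. ennreal (indicator {0..c} t * t powr (a - 1)) \<partial>lborel)"
      using that by (intro nn_integral_cong) (auto split: split_indicator)
    also have "\<dots> = ennreal (c powr a / a)"
      using nn_integral_has_integral_lebesgue[OF _ has_integral_powr_from_0[of "a - 1" c]] assms that
      by simp
    finally show ?thesis .
  qed
  show ?thesis
  proof (cases d)
    case (real c)
    then show ?thesis
      using assms finite[of c]
      by (simp add: enn_powr_ennreal flip: ennreal_mult)
  next
    case top
    \<comment> \<open>The integral exceeds every \<open>y\<close>, as its part up to \<open>(y a) powr (1 / a)\<close> already equals \<open>y\<close>.\<close>
    have big: "ennreal y \<le> ?I top" if "0 \<le> y" for y
    proof -
      have "ennreal y = ?I (ennreal ((y * a) powr (1 / a)))"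
        using assms that by (subst finite) (simp_all add: powr_powr)
      also have "\<dots> \<le> ?I top"
        by (intro nn_integral_mono) (auto split: split_indicator)
      finally show ?thesis .
    qed
    have "?I top = top"
    proof (rule ccontr)
      assume "?I top \<noteq> top"
      then obtain j where "0 \<le> j" "?I top = ennreal j" by (meson ennreal_cases)
      then show False using big[of "j + 1"] by simp
    qed
    then show ?thesis using top assms by (simp add: ennreal_mult_top)
  qed
qed

text \<open>
  Layer cake: \<open>D(s)\<^bsup>a\<^esup>\<close> is the integral of \<open>a t\<^bsup>a - 1\<^esup>\<close> over \<open>t \<le> D(s)\<close>. After exchanging
  the integrals, the inner one runs over those \<open>s\<close> with \<open>t \<le> D(s)\<close>, and the hypothesis confines
  them to \<open>s \<le> K(t) / t\<close>. This avoids introducing a rearrangement, that is, a generalized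
  inverse of \<open>D\<close>.
\<close>
lemma Lq_star_le_of_lower_bound:
  fixes D K :: "real \<Rightarrow> ennreal"
  assumes [measurable]: "D \<in> borel_measurable borel" "K \<in> borel_measurable borel"
    and \<theta>: "0 < \<theta>" "\<theta> < 1" and "0 < q"
    and K: "\<And>s t. 0 < s \<Longrightarrow> 0 < t \<Longrightarrow> ennreal t \<le> D s \<Longrightarrow> ennreal (s * t) \<le> K t"
  shows "Lq_star q (\<lambda>s. ennreal s * enn_powr (D s) (1 - \<theta>))
         \<le> Lq_star q (\<lambda>t. ennreal (t powr (- \<theta>)) * K t)"
proof (cases "q = \<infinity>")
  case True
  define N where "N = (SUP t\<in>{0<..}. ennreal (t powr (- \<theta>)) * K t)"
  have "ennreal s * enn_powr (D s) (1 - \<theta>) \<le> N" if "0 < s" for s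
  proof -
    have "y \<le> enn_powr (N * ennreal (1 / s)) (1 / (1 - \<theta>))" if "y < D s" for y
    proof -
      from that obtain t where t: "0 \<le> t" "y = ennreal t" by (cases y) auto
      show ?thesis
      proof (cases "t = 0")
        case False
        then have "0 < t" using t by simp
        have "ennreal (t powr (1 - \<theta>)) = ennreal (t powr (- \<theta>)) * ennreal (s * t) * ennreal (1 / s)"
          using \<open>0 < t\<close> \<open>0 < s\<close> by (simp add: powr_diff powr_minus_divide flip: ennreal_mult)
        also have "\<dots> \<le> ennreal (t powr (- \<theta>)) * K t * ennreal (1 / s)"
          using K[of s t] t that \<open>0 < t\<close> \<open>0 < s\<close> by (intro mult_right_mono mult_left_mono) auto
        also have "\<dots> \<le> N * ennreal (1 / s)"
          unfolding N_def using \<open>0 < t\<close> by (intro mult_right_mono SUP_upper) auto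
        finally show ?thesis
          using t \<theta> by (simp add: enn_powr_ennreal flip: enn_powr_le_iff)
      qed (use t in simp)
    qed
    then have "D s \<le> enn_powr (N * ennreal (1 / s)) (1 / (1 - \<theta>))" by (rule dense_le)
    then have "enn_powr (D s) (1 - \<theta>) \<le> N * ennreal (1 / s)"
      using \<theta> by (simp add: enn_powr_le_iff)
    then have "ennreal s * enn_powr (D s) (1 - \<theta>) \<le> ennreal s * (N * ennreal (1 / s))"
      by (rule mult_left_mono) simp
    also have "\<dots> = N * (ennreal s * ennreal (1 / s))" by (simp add: mult_ac)
    also have "\<dots> = N" using that by (simp flip: ennreal_mult)
    finally show ?thesis .
  qed
  then show ?thesis
    using True by (auto simp: Lq_star_def N_def intro!: SUP_least)
next
  case False
  define Q where "Q = enn2real q"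
  have "Q > 0" using False assms by (simp add: Q_def enn2real_positive_iff less_top)
  define \<alpha> where "\<alpha> = (1 - \<theta>) * Q"
  have "\<alpha> > 0" using \<theta> \<open>Q > 0\<close> by (simp add: \<alpha>_def)
  define F where "F = (\<lambda>s t. ennreal (s powr (Q - 1)) * indicator {0<..} s *
      (ennreal (t powr (\<alpha> - 1)) * indicator {t. ennreal t \<le> D s} t * indicator {0<..} t))"
  have F_meas [measurable]: "case_prod F \<in> borel_measurable (lborel \<Otimes>\<^sub>M lborel)"
    unfolding F_def indicator_def by measurable
  have "(\<integral>\<^sup>+ s\<in>{0<..}. enn_powr (ennreal s * enn_powr (D s) (1 - \<theta>)) Q * ennreal (1 / s) \<partial>lborel)
      = (\<integral>\<^sup>+ s. ennreal \<alpha> * (\<integral>\<^sup>+ t. F s t \<partial>lborel) \<partial>lborel)"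
  proof (intro nn_integral_cong)
    fix s :: real
    have "(\<integral>\<^sup>+ t. F s t \<partial>lborel) = ennreal (s powr (Q - 1)) * indicator {0<..} s *
       (ennreal (1 / \<alpha>) * enn_powr (D s) \<alpha>)"
      unfolding F_def by (subst nn_integral_cmult) (simp_all add: nn_integral_powr_upto[OF \<open>\<alpha> > 0\<close>])
    then have *: "ennreal \<alpha> * (\<integral>\<^sup>+ t. F s t \<partial>lborel) = (ennreal \<alpha> * ennreal (1 / \<alpha>)) *
       (ennreal (s powr (Q - 1)) * indicator {0<..} s * enn_powr (D s) \<alpha>)"
      by (simp add: mult_ac)
    have "ennreal \<alpha> * ennreal (1 / \<alpha>) = 1"
      using \<open>\<alpha> > 0\<close> by (simp flip: ennreal_mult)
    then show "enn_powr (ennreal s * enn_powr (D s) (1 - \<theta>)) Q * ennreal (1 / s) * indicator {0<..} s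
      = ennreal \<alpha> * (\<integral>\<^sup>+ t. F s t \<partial>lborel)"
      unfolding * using \<open>ennreal \<alpha> * ennreal (1 / \<alpha>) = 1\<close>
      by (auto simp: enn_powr_mult enn_powr_powr enn_powr_ennreal \<alpha>_def powr_diff ennreal_mult
          divide_inverse mult_ac split: split_indicator)
  qed
  also have "\<dots> = ennreal \<alpha> * (\<integral>\<^sup>+ s. (\<integral>\<^sup>+ t. F s t \<partial>lborel) \<partial>lborel)"
    by (intro nn_integral_cmult) measurable
  also have "\<dots> = ennreal \<alpha> * (\<integral>\<^sup>+ t. (\<integral>\<^sup>+ s. F s t \<partial>lborel) \<partial>lborel)"
    by (rule arg_cong[OF lborel_pair.Fubini'[OF F_meas, symmetric]])
  also have "\<dots> \<le> ennreal \<alpha> * (\<integral>\<^sup>+ t. ennreal (1 / Q) * (enn_powr (ennreal (t powr (- \<theta>)) * K t) Q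
      * ennreal (1 / t) * indicator {0<..} t) \<partial>lborel)"
  proof (intro mult_left_mono nn_integral_mono)
    fix t :: real
    show "(\<integral>\<^sup>+ s. F s t \<partial>lborel) \<le> ennreal (1 / Q) * (enn_powr (ennreal (t powr (- \<theta>)) * K t) Q
      * ennreal (1 / t) * indicator {0<..} t)"
    proof (cases "0 < t")
      case False
      then show ?thesis by (simp add: F_def)
    next
      case True
      have "ennreal s \<le> K t * ennreal (1 / t)" if "0 < s" "ennreal t \<le> D s" for s
      proof -
        have "ennreal s = ennreal (s * t) * ennreal (1 / t)"
          using True that by (simp flip: ennreal_mult)
        also have "\<dots> \<le> K t * ennreal (1 / t)"
          using K[OF that(1) True that(2)] by (rule mult_right_mono) simp
        finally show ?thesis .
      qed
      then have "(\<integral>\<^sup>+ s. F s t \<partial>lborel) \<le> (\<integral>\<^sup>+ s. ennreal (t powr (\<alpha> - 1)) *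
          (ennreal (s powr (Q - 1)) * indicator {s. ennreal s \<le> K t * ennreal (1 / t)} s * indicator {0<..} s) \<partial>lborel)"
        by (intro nn_integral_mono) (auto simp: F_def mult_ac split: split_indicator)
      also have "\<dots> = ennreal (t powr (\<alpha> - 1)) * (ennreal (1 / Q) * enn_powr (K t * ennreal (1 / t)) Q)"
        by (subst nn_integral_cmult) (simp_all add: nn_integral_powr_upto[OF \<open>Q > 0\<close>])
      also have "\<dots> = ennreal (1 / Q) * (enn_powr (K t) Q * ennreal (t powr (\<alpha> - 1) * (1 / t) powr Q))"
        using True by (simp add: enn_powr_mult enn_powr_ennreal ennreal_mult mult_ac)
      also have "t powr (\<alpha> - 1) * (1 / t) powr Q = (t powr (- \<theta>)) powr Q * (1 / t)"
        using True by (simp add: \<alpha>_def powr_powr powr_divide powr_diff powr_minus_divide powr_add algebra_simps)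
      also have "enn_powr (K t) Q * ennreal ((t powr (- \<theta>)) powr Q * (1 / t))
          = enn_powr (ennreal (t powr (- \<theta>)) * K t) Q * ennreal (1 / t)"
        using True by (simp add: enn_powr_mult enn_powr_ennreal mult_ac flip: ennreal_mult)
      finally show ?thesis using True by simp
    qed
  qed simp
  also have "\<dots> = ennreal \<alpha> * (ennreal (1 / Q) * (\<integral>\<^sup>+ t\<in>{0<..}. enn_powr (ennreal (t powr (- \<theta>)) * K t) Q
      * ennreal (1 / t) \<partial>lborel))"
    by (subst nn_integral_cmult) simp_all
  also have "\<dots> = ennreal (1 - \<theta>) * (\<integral>\<^sup>+ t\<in>{0<..}. enn_powr (ennreal (t powr (- \<theta>)) * K t) Q
      * ennreal (1 / t) \<partial>lborel)"
    using \<open>Q > 0\<close> \<theta> by (simp add: \<alpha>_def flip: mult.assoc ennreal_mult)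
  also have "\<dots> \<le> 1 * (\<integral>\<^sup>+ t\<in>{0<..}. enn_powr (ennreal (t powr (- \<theta>)) * K t) Q
      * ennreal (1 / t) \<partial>lborel)"
    using \<theta> by (intro mult_right_mono) (simp_all add: ennreal_le_1)
  finally show ?thesis
    unfolding Lq_star_def if_not_P[OF False] Q_def[symmetric]
    using \<open>Q > 0\<close> by (intro enn_powr_mono) simp_all
qed

text \<open>
  The integrand is \<open>t\<^bsup>a - 1\<^esup>\<close> below \<open>d\<close> and \<open>d\<^bsup>b\<^esup> t\<^bsup>a - b - 1\<^esup>\<close> above it; the two parts contribute
  \<open>1 / a\<close> and \<open>1 / (b - a)\<close>.
\<close>
lemma nn_integral_powr_min_le:
  assumes "0 < a" "a < b"
  shows "(\<integral>\<^sup>+ t\<in>{0<..}. ennreal (t powr (a - b - 1)) * enn_powr (min d (ennreal t)) b \<partial>lborel)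
         \<le> ennreal (1 / a + 1 / (b - a)) * enn_powr d a" (is "?I \<le> _")
proof (cases d)
  case (real c)
  show ?thesis
  proof (cases "c = 0")
    case True
    then show ?thesis using real by simp
  next
    case False
    then have "0 < c" using real by simp
    have int: "((\<lambda>t. t powr (a - b - 1)) has_integral (c powr (a - b) / (b - a))) {c..}"
      using has_integral_powr_to_inf[of "a - b - 1" c] assms \<open>0 < c\<close>
      by (simp add: minus_divide_divide[symmetric, of _ "a - b"] del: minus_divide_divide)
    have "?I \<le> (\<integral>\<^sup>+ t. ennreal (t powr (a - 1)) * indicator {t. ennreal t \<le> d} t * indicator {0<..} t
        + ennreal (c powr b) * ennreal (indicator {c..} t * t powr (a - b - 1)) \<partial>lborel)"
    proof (intro nn_integral_mono)
      fix t :: real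
      show "ennreal (t powr (a - b - 1)) * enn_powr (min d (ennreal t)) b * indicator {0<..} t
        \<le> ennreal (t powr (a - 1)) * indicator {t. ennreal t \<le> d} t * indicator {0<..} t
          + ennreal (c powr b) * ennreal (indicator {c..} t * t powr (a - b - 1))"
      proof (cases "0 < t")
        case True
        show ?thesis
        proof (cases "t \<le> c")
          case True
          then have "min d (ennreal t) = ennreal t" using real by (simp add: min_absorb2 ennreal_leI)
          moreover have "t powr (a - b - 1) * t powr b = t powr (a - 1)"
            by (simp flip: powr_add)
          ultimately show ?thesis
            using \<open>0 < t\<close> True real
            by (auto simp: enn_powr_ennreal ennreal_leI simp flip: ennreal_mult intro: add_increasing2)
        next
          case False
          then have "min d (ennreal t) = ennreal c" using real by (simp add: min_absorb1 ennreal_leI)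
          then show ?thesis
            using \<open>0 < t\<close> False real
            by (simp add: enn_powr_ennreal mult.commute add_increasing flip: ennreal_mult)
        qed
      qed simp
    qed
    also have "\<dots> = ennreal (1 / a) * enn_powr d a + ennreal (c powr b) * ennreal (c powr (a - b) / (b - a))"
    proof (subst nn_integral_add)
      show "(\<integral>\<^sup>+ t. ennreal (t powr (a - 1)) * indicator {t. ennreal t \<le> d} t * indicator {0<..} t \<partial>lborel)
        + (\<integral>\<^sup>+ t. ennreal (c powr b) * ennreal (indicator {c..} t * t powr (a - b - 1)) \<partial>lborel)
       = ennreal (1 / a) * enn_powr d a + ennreal (c powr b) * ennreal (c powr (a - b) / (b - a))"
        using nn_integral_has_integral_lebesgue[OF _ int]
        by (subst nn_integral_cmult) (simp_all add: nn_integral_powr_upto[OF assms(1)])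
    qed measurable
    also have "\<dots> = ennreal (1 / a + 1 / (b - a)) * enn_powr d a"
    proof -
      have "c powr b * (c powr (a - b) / (b - a)) = 1 / (b - a) * c powr a"
        by (simp flip: powr_add)
      then show ?thesis
        using real assms by (simp add: enn_powr_ennreal distrib_right flip: ennreal_mult ennreal_plus)
    qed
    finally show ?thesis .
  qed
next
  case top
  moreover have "1 / a + 1 / (b - a) > 0" using assms by (simp add: add_pos_pos)
  ultimately show ?thesis by (simp add: ennreal_mult_top)
qed

text \<open>
  The hypothesis bounds \<open>K(t)\<close> by \<open>t\<^bsup>\<epsilon>\<^esup>\<close> times a supremum over \<open>s\<close>. Since \<open>D\<close> is decreasing, that
  supremum is controlled by the corresponding integral over \<open>s\<close>; in this way every \<open>q\<close> is treated
  alike and no Hardy inequality is needed. After exchanging integrals, the one over \<open>t\<close> converges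
  at infinity because \<open>\<epsilon> < \<theta>\<close> and at zero because \<open>\<theta> < 1\<close>. The constant depends only on
  \<open>\<epsilon>\<close>, \<open>\<theta>\<close> and \<open>q\<close>.
\<close>
lemma Lq_star_le_of_upper_bound:
  fixes q :: ennreal
  assumes \<theta>: "0 < \<epsilon>" "\<epsilon> < \<theta>" "\<theta> < 1" and "0 < q"
  shows "\<exists>B>0. \<forall>D K. antimono D \<longrightarrow> K \<in> borel_measurable borel \<longrightarrow>
     (\<forall>t>0. \<forall>m. (\<forall>s>0. ennreal s * enn_powr (min (D s) (ennreal t)) (1 - \<epsilon>) \<le> m)
        \<longrightarrow> K t \<le> ennreal (t powr \<epsilon>) * m) \<longrightarrow>
     Lq_star q (\<lambda>t. ennreal (t powr (- \<theta>)) * K t)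
       \<le> ennreal B * Lq_star q (\<lambda>s. ennreal s * enn_powr (D s) (1 - \<theta>))"
proof (cases "q = \<infinity>")
  case True
  show ?thesis
  proof (intro exI[of _ 1] conjI allI impI)
    fix D K :: "real \<Rightarrow> ennreal"
    assume K: "\<forall>t>0. \<forall>m. (\<forall>s>0. ennreal s * enn_powr (min (D s) (ennreal t)) (1 - \<epsilon>) \<le> m)
        \<longrightarrow> K t \<le> ennreal (t powr \<epsilon>) * m"
    define N where "N = (SUP s\<in>{0<..}. ennreal s * enn_powr (D s) (1 - \<theta>))"
    have "ennreal (t powr (- \<theta>)) * K t \<le> N" if "0 < t" for t
    proof -
      have "K t \<le> ennreal (t powr \<epsilon>) * (ennreal (t powr (\<theta> - \<epsilon>)) * N)"
      proof (rule K[rule_format, OF that])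
        fix s :: real assume "0 < s"
        \<comment> \<open>Of the power \<open>1 - \<epsilon>\<close> of the minimum, \<open>\<theta> - \<epsilon>\<close> is spent on \<open>t\<close> and the rest on \<open>D s\<close>.\<close>
        have "enn_powr x (1 - \<epsilon>) = enn_powr x (\<theta> - \<epsilon>) * enn_powr x (1 - \<theta>)" if "x \<noteq> top" for x
          using that by (cases x) (simp_all add: enn_powr_ennreal flip: ennreal_mult powr_add)
        moreover have "min (D s) (ennreal t) \<noteq> top"
          by (metis ennreal_neq_top min.cobounded2 neq_top_trans)
        ultimately have "enn_powr (min (D s) (ennreal t)) (1 - \<epsilon>)
            = enn_powr (min (D s) (ennreal t)) (\<theta> - \<epsilon>) * enn_powr (min (D s) (ennreal t)) (1 - \<theta>)"
          by simp
        also have "\<dots> \<le> enn_powr (ennreal t) (\<theta> - \<epsilon>) * enn_powr (D s) (1 - \<theta>)"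
          using \<theta> by (intro mult_mono enn_powr_mono) auto
        finally have "ennreal s * enn_powr (min (D s) (ennreal t)) (1 - \<epsilon>)
            \<le> ennreal s * (enn_powr (ennreal t) (\<theta> - \<epsilon>) * enn_powr (D s) (1 - \<theta>))"
          by (rule mult_left_mono) simp
        also have "\<dots> = ennreal (t powr (\<theta> - \<epsilon>)) * (ennreal s * enn_powr (D s) (1 - \<theta>))"
          using that by (simp add: enn_powr_ennreal mult_ac)
        also have "\<dots> \<le> ennreal (t powr (\<theta> - \<epsilon>)) * N"
          unfolding N_def using \<open>0 < s\<close> by (intro mult_left_mono SUP_upper) auto
        finally show "ennreal s * enn_powr (min (D s) (ennreal t)) (1 - \<epsilon>) \<le> ennreal (t powr (\<theta> - \<epsilon>)) * N" .
      qed
      then have "ennreal (t powr (- \<theta>)) * K t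
          \<le> ennreal (t powr (- \<theta>)) * (ennreal (t powr \<epsilon>) * (ennreal (t powr (\<theta> - \<epsilon>)) * N))"
        by (rule mult_left_mono) simp
      also have "\<dots> = ennreal (t powr (- \<theta>) * t powr \<epsilon> * t powr (\<theta> - \<epsilon>)) * N"
        by (simp add: ennreal_mult mult_ac)
      also have "t powr (- \<theta>) * t powr \<epsilon> * t powr (\<theta> - \<epsilon>) = 1"
        using that by (simp flip: powr_add)
      finally show ?thesis by simp
    qed
    then show "Lq_star q (\<lambda>t. ennreal (t powr (- \<theta>)) * K t)
         \<le> ennreal 1 * Lq_star q (\<lambda>s. ennreal s * enn_powr (D s) (1 - \<theta>))"
      using True by (auto simp: Lq_star_def N_def intro!: SUP_least)
  qed simp
next
  case False
  define Q where "Q = enn2real q"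
  have "Q > 0" using False assms by (simp add: Q_def enn2real_positive_iff less_top)
  define a b where "a = (1 - \<theta>) * Q" and "b = (1 - \<epsilon>) * Q"
  have ab: "0 < a" "a < b" "0 < b" using \<theta> \<open>Q > 0\<close> by (simp_all add: a_def b_def)
  define B where "B = Q * (1 / a + 1 / (b - a))"
  have "B > 0" using ab \<open>Q > 0\<close> by (simp add: B_def add_pos_pos)
  show ?thesis
  proof (intro exI[of _ "B powr (1 / Q)"] conjI allI impI)
    show "B powr (1 / Q) > 0" using \<open>B > 0\<close> by simp
    fix D K :: "real \<Rightarrow> ennreal"
    assume D: "antimono D" and K_meas [measurable]: "K \<in> borel_measurable borel"
      and K: "\<forall>t>0. \<forall>m. (\<forall>s>0. ennreal s * enn_powr (min (D s) (ennreal t)) (1 - \<epsilon>) \<le> m)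
        \<longrightarrow> K t \<le> ennreal (t powr \<epsilon>) * m"
    note [measurable] = borel_measurable_antimono_ennreal[OF D]
    \<comment> \<open>\<open>Q I(t)\<close> dominates the \<open>Q\<close>-th power of the supremum in the hypothesis on \<open>K\<close>.\<close>
    define I where "I = (\<lambda>t. \<integral>\<^sup>+ s\<in>{0<..}. ennreal (s powr (Q - 1)) * enn_powr (min (D s) (ennreal t)) b \<partial>lborel)"
    have I: "ennreal (s powr Q) * enn_powr (min (D s) (ennreal t)) b \<le> ennreal Q * I t"
      if "0 < s" for s t
    proof -
      have "ennreal (1 / Q) * ennreal (s powr Q) * enn_powr (min (D s) (ennreal t)) b
        = (\<integral>\<^sup>+ u\<in>{0<..}. ennreal (u powr (Q - 1)) * indicator {u. ennreal u \<le> ennreal s} u \<partial>lborel)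
            * enn_powr (min (D s) (ennreal t)) b"
        using that \<open>Q > 0\<close> by (subst nn_integral_powr_upto) (simp_all add: enn_powr_ennreal)
      also have "\<dots> = (\<integral>\<^sup>+ u. ennreal (u powr (Q - 1)) * indicator {u. ennreal u \<le> ennreal s} u
            * indicator {0<..} u * enn_powr (min (D s) (ennreal t)) b \<partial>lborel)"
        by (rule nn_integral_multc[symmetric]) measurable
      also have "\<dots> \<le> I t"
        unfolding I_def using that ab D
        by (intro nn_integral_mono)
           (auto split: split_indicator simp: ennreal_le_iff antimono_def
             intro!: mult_left_mono enn_powr_mono min.mono)
      finally have "ennreal Q * (ennreal (1 / Q) * ennreal (s powr Q) * enn_powr (min (D s) (ennreal t)) b)
          \<le> ennreal Q * I t"
        by (rule mult_left_mono) simp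
      moreover have "ennreal Q * (ennreal (1 / Q) * ennreal (s powr Q) * enn_powr (min (D s) (ennreal t)) b)
        = ennreal Q * ennreal (1 / Q) * (ennreal (s powr Q) * enn_powr (min (D s) (ennreal t)) b)"
        by (simp add: mult_ac)
      moreover have "ennreal Q * ennreal (1 / Q) = 1"
        using \<open>Q > 0\<close> by (simp flip: ennreal_mult)
      ultimately show ?thesis by simp
    qed
    have KI: "enn_powr (K t) Q \<le> ennreal (t powr (\<epsilon> * Q)) * (ennreal Q * I t)" if "0 < t" for t
    proof -
      have "K t \<le> ennreal (t powr \<epsilon>) * enn_powr (ennreal Q * I t) (1 / Q)"
      proof (rule K[rule_format, OF that])
        fix s :: real assume "0 < s"
        then have "enn_powr (ennreal s * enn_powr (min (D s) (ennreal t)) (1 - \<epsilon>)) Q \<le> ennreal Q * I t"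
          using I[of s t] by (simp add: enn_powr_mult enn_powr_powr enn_powr_ennreal b_def)
        then show "ennreal s * enn_powr (min (D s) (ennreal t)) (1 - \<epsilon>) \<le> enn_powr (ennreal Q * I t) (1 / Q)"
          using \<open>Q > 0\<close> by (simp add: enn_powr_le_iff)
      qed
      then have "enn_powr (K t) Q \<le> enn_powr (ennreal (t powr \<epsilon>) * enn_powr (ennreal Q * I t) (1 / Q)) Q"
        using \<open>Q > 0\<close> by (intro enn_powr_mono) auto
      then show ?thesis
        using \<open>Q > 0\<close> by (simp add: enn_powr_mult enn_powr_powr enn_powr_ennreal powr_powr)
    qed
    define F where "F = (\<lambda>t s. ennreal (s powr (Q - 1)) * indicator {0<..} s *
      (ennreal (t powr (a - b - 1)) * enn_powr (min (D s) (ennreal t)) b * indicator {0<..} t))"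
    have F_meas [measurable]: "case_prod F \<in> borel_measurable (lborel \<Otimes>\<^sub>M lborel)"
      unfolding F_def by measurable
    have "(\<integral>\<^sup>+ t\<in>{0<..}. enn_powr (ennreal (t powr (- \<theta>)) * K t) Q * ennreal (1 / t) \<partial>lborel)
        \<le> (\<integral>\<^sup>+ t. ennreal Q * (\<integral>\<^sup>+ s. F t s \<partial>lborel) \<partial>lborel)"
    proof (intro nn_integral_mono)
      fix t :: real
      show "enn_powr (ennreal (t powr (- \<theta>)) * K t) Q * ennreal (1 / t) * indicator {0<..} t
        \<le> ennreal Q * (\<integral>\<^sup>+ s. F t s \<partial>lborel)"
      proof (cases "0 < t")
        case True
        have "enn_powr (ennreal (t powr (- \<theta>)) * K t) Q * ennreal (1 / t)
            = ennreal ((t powr (- \<theta>)) powr Q * (1 / t)) * enn_powr (K t) Q"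
          using True by (simp add: enn_powr_mult enn_powr_ennreal mult_ac flip: ennreal_mult)
        also have "\<dots> \<le> ennreal ((t powr (- \<theta>)) powr Q * (1 / t)) *
            (ennreal (t powr (\<epsilon> * Q)) * (ennreal Q * I t))"
          using KI[OF True] by (rule mult_left_mono) simp
        also have "\<dots> = ennreal Q * (ennreal ((t powr (- \<theta>)) powr Q * (1 / t) * t powr (\<epsilon> * Q)) * I t)"
          by (subst ennreal_mult[of "(t powr (- \<theta>)) powr Q * (1 / t)" "t powr (\<epsilon> * Q)"])
             (use True in \<open>simp_all add: mult_ac\<close>)
        also have "(t powr (- \<theta>)) powr Q * (1 / t) * t powr (\<epsilon> * Q) = t powr (a - b - 1)"
          using True unfolding powr_powr
          by (simp add: powr_diff powr_minus_divide a_def b_def left_diff_distrib)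
        also have "ennreal (t powr (a - b - 1)) * I t = (\<integral>\<^sup>+ s. F t s \<partial>lborel)"
          unfolding I_def using True
          by (subst nn_integral_cmult[symmetric]) (auto simp: F_def mult_ac intro!: nn_integral_cong)
        finally show ?thesis using True by simp
      qed simp
    qed
    also have "\<dots> = ennreal Q * (\<integral>\<^sup>+ t. (\<integral>\<^sup>+ s. F t s \<partial>lborel) \<partial>lborel)"
      by (intro nn_integral_cmult) measurable
    also have "\<dots> = ennreal Q * (\<integral>\<^sup>+ s. (\<integral>\<^sup>+ t. F t s \<partial>lborel) \<partial>lborel)"
      by (rule arg_cong[OF lborel_pair.Fubini'[OF F_meas, symmetric]])
    also have "\<dots> \<le> ennreal Q * (\<integral>\<^sup>+ s. ennreal (1 / a + 1 / (b - a)) *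
        (enn_powr (ennreal s * enn_powr (D s) (1 - \<theta>)) Q * ennreal (1 / s) * indicator {0<..} s) \<partial>lborel)"
    proof (intro mult_left_mono nn_integral_mono)
      fix s :: real
      have "(\<integral>\<^sup>+ t. F t s \<partial>lborel) = ennreal (s powr (Q - 1)) * indicator {0<..} s *
          (\<integral>\<^sup>+ t\<in>{0<..}. ennreal (t powr (a - b - 1)) * enn_powr (min (D s) (ennreal t)) b \<partial>lborel)"
        unfolding F_def by (rule nn_integral_cmult) measurable
      also have "\<dots> \<le> ennreal (s powr (Q - 1)) * indicator {0<..} s *
          (ennreal (1 / a + 1 / (b - a)) * enn_powr (D s) a)"
        using ab by (intro mult_left_mono nn_integral_powr_min_le) auto
      also have "\<dots> = ennreal (1 / a + 1 / (b - a)) *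
          (enn_powr (ennreal s * enn_powr (D s) (1 - \<theta>)) Q * ennreal (1 / s) * indicator {0<..} s)"
        by (auto simp: enn_powr_mult enn_powr_powr enn_powr_ennreal a_def powr_diff ennreal_mult
            divide_inverse mult_ac split: split_indicator)
      finally show "(\<integral>\<^sup>+ t. F t s \<partial>lborel) \<le> ennreal (1 / a + 1 / (b - a)) *
          (enn_powr (ennreal s * enn_powr (D s) (1 - \<theta>)) Q * ennreal (1 / s) * indicator {0<..} s)" .
    qed simp
    also have "\<dots> = ennreal B * (\<integral>\<^sup>+ s\<in>{0<..}. enn_powr (ennreal s * enn_powr (D s) (1 - \<theta>)) Q
        * ennreal (1 / s) \<partial>lborel)"
      using ab \<open>Q > 0\<close> by (subst nn_integral_cmult) (simp_all add: B_def ennreal_mult mult_ac)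
    finally have "enn_powr (\<integral>\<^sup>+ t\<in>{0<..}. enn_powr (ennreal (t powr (- \<theta>)) * K t) Q * ennreal (1 / t) \<partial>lborel) (1 / Q)
      \<le> enn_powr (ennreal B * (\<integral>\<^sup>+ s\<in>{0<..}. enn_powr (ennreal s * enn_powr (D s) (1 - \<theta>)) Q
        * ennreal (1 / s) \<partial>lborel)) (1 / Q)"
      using \<open>Q > 0\<close> by (intro enn_powr_mono) auto
    then show "Lq_star q (\<lambda>t. ennreal (t powr (- \<theta>)) * K t)
         \<le> ennreal (B powr (1 / Q)) * Lq_star q (\<lambda>s. ennreal s * enn_powr (D s) (1 - \<theta>))"
      unfolding Lq_star_def if_not_P[OF False] Q_def[symmetric]
      using \<open>B > 0\<close> by (simp add: enn_powr_mult enn_powr_ennreal)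
  qed
qed

section \<open>Luxemburg norms of indicator functions\<close>

lemma phi_mono: "0 \<le> s \<Longrightarrow> s \<le> t \<Longrightarrow> phi p s \<le> phi p t"
  by (auto simp: phi_def intro!: ennreal_leI powr_mono2)

lemma modular_mono_AE:
  assumes "AE x in lebesgue. norm (f x) \<le> norm (g x)"
  shows "modular p f \<le> modular p g"
  unfolding modular_def using assms
  by (intro nn_integral_mono_AE) (auto elim!: eventually_mono intro!: phi_mono)

lemma Lp_norm_le: "0 < \<mu> \<Longrightarrow> modular p (\<lambda>x. f x /\<^sub>R \<mu>) \<le> 1 \<Longrightarrow> Lp_norm p f \<le> ennreal \<mu>"
  unfolding Lp_norm_def by (intro Inf_lower) auto

lemma modular_le_1_of_Lp_norm_less:
  assumes "Lp_norm p f < ennreal \<mu>" shows "modular p (\<lambda>x. f x /\<^sub>R \<mu>) \<le> 1"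
proof -
  obtain \<nu> where \<nu>: "0 < \<nu>" "modular p (\<lambda>x. f x /\<^sub>R \<nu>) \<le> 1" "ennreal \<nu> < ennreal \<mu>"
    using assms unfolding Lp_norm_def Inf_less_iff by auto
  then have "\<nu> < \<mu>" by (simp add: ennreal_less_iff)
  then have "modular p (\<lambda>x. f x /\<^sub>R \<mu>) \<le> modular p (\<lambda>x. f x /\<^sub>R \<nu>)"
    using \<open>0 < \<nu>\<close> by (intro modular_mono_AE always_eventually allI) (auto intro!: mult_right_mono)
  then show ?thesis using \<nu> by simp
qed

lemma Lp_norm_mono_AE:
  assumes "AE x in lebesgue. norm (f x) \<le> norm (g x)"
  shows "Lp_norm p f \<le> Lp_norm p g"
  unfolding Lp_norm_def
proof (intro Inf_superset_mono subsetI, clarify)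
  fix \<mu> :: real assume "0 < \<mu>" "modular p (\<lambda>x. g x /\<^sub>R \<mu>) \<le> 1"
  moreover have "modular p (\<lambda>x. f x /\<^sub>R \<mu>) \<le> modular p (\<lambda>x. g x /\<^sub>R \<mu>)"
    using assms by (intro modular_mono_AE) (auto elim!: eventually_mono intro!: mult_left_mono)
  ultimately show "\<exists>\<nu>. ennreal \<mu> = ennreal \<nu> \<and> 0 < \<nu> \<and> modular p (\<lambda>x. f x /\<^sub>R \<nu>) \<le> 1"
    by (intro exI[of _ \<mu>]) auto
qed

lemma superlevel_norm_mono_AE:
  assumes "AE x in lebesgue. s < norm (f x) \<longrightarrow> t < norm (g x)"
  shows "superlevel_norm p f s \<le> superlevel_norm p g t"
  unfolding superlevel_norm_def using assms
  by (intro Lp_norm_mono_AE) (auto elim!: eventually_mono split: split_indicator)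

lemma antimono_superlevel_norm: "antimono (superlevel_norm p f)"
  by (auto simp: antimono_def intro!: superlevel_norm_mono_AE)

text \<open>
  For an indicator function, dividing the exponent by \<open>1 - \<theta>\<close> amounts to replacing the scale
  \<open>\<mu>\<close> in the modular by \<open>\<mu>\<^bsup>1 / (1 - \<theta>)\<^esup>\<close>. This also holds where the exponent is infinite, because
  both scales lie on the same side of \<open>1\<close>.
\<close>
lemma Lp_norm_indicator_dilate:
  fixes A :: "(real ^ 'n) set"
  assumes "\<theta> < 1" and pos: "\<And>x. 0 < p x"
    and pt: "\<And>x. 1 / pt x = ennreal (1 - \<theta>) / p x"
  shows "Lp_norm pt (indicator A :: real ^ 'n \<Rightarrow> real) = enn_powr (Lp_norm p (indicator A :: real ^ 'n \<Rightarrow> real)) (1 - \<theta>)"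
proof -
  have phi_eq: "phi (pt x) (norm (indicator A x /\<^sub>R \<mu> :: real))
      = phi (p x) (norm (indicator A x /\<^sub>R \<mu> powr (1 / (1 - \<theta>)) :: real))" if "0 < \<mu>" for \<mu> x
  proof (cases "p x")
    case top
    then have "1 / pt x = 0" using pt[of x] by simp
    then have "pt x = top" by (simp add: ennreal_divide_eq_0_iff)
    moreover have "inverse \<mu> \<le> 1 \<longleftrightarrow> inverse (\<mu> powr (1 / (1 - \<theta>))) \<le> 1"
      using that \<open>\<theta> < 1\<close> powr_less_mono2[of "1 / (1 - \<theta>)" \<mu> 1] ge_one_powr_ge_zero[of \<mu> "1 / (1 - \<theta>)"]
      by (cases "1 \<le> \<mu>") (simp_all add: inverse_le_1_iff)
    ultimately show ?thesis using top that by (auto simp: phi_def split: split_indicator)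
  next
    case (real c)
    then have "0 < c" using pos[of x] by simp
    have "1 / pt x = ennreal ((1 - \<theta>) / c)"
      using pt[of x] real \<open>0 < c\<close> \<open>\<theta> < 1\<close> by (simp add: divide_ennreal)
    moreover obtain d where "0 \<le> d" "pt x = ennreal d"
      using calculation \<open>0 < c\<close> \<open>\<theta> < 1\<close> by (cases "pt x") auto
    moreover from calculation have "0 < d"
      by (cases "d = 0") auto
    ultimately have "1 / d = (1 - \<theta>) / c" and [simp]: "pt x = ennreal d"
      using \<open>0 < c\<close> \<open>\<theta> < 1\<close> by (simp_all add: divide_ennreal flip: ennreal_1)
    then have d: "d = 1 / (1 - \<theta>) * c"
      using \<open>0 < d\<close> \<open>0 < c\<close> \<open>\<theta> < 1\<close> by (simp add: field_simps)
    show ?thesis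
      using real \<open>0 < c\<close> \<open>0 < d\<close> that
      by (auto simp: phi_def d powr_powr inverse_powr powr_minus split: split_indicator)
  qed
  have modular_eq: "modular pt (\<lambda>x. indicator A x /\<^sub>R \<mu> :: real)
      = modular p (\<lambda>x. indicator A x /\<^sub>R \<mu> powr (1 / (1 - \<theta>)) :: real)" if "0 < \<mu>" for \<mu>
    unfolding modular_def by (simp only: phi_eq[OF that])
  let ?N = "Lp_norm p (indicator A :: real ^ 'n \<Rightarrow> real)"
  let ?Nt = "Lp_norm pt (indicator A :: real ^ 'n \<Rightarrow> real)"
  show ?thesis
  proof (rule antisym)
    have "enn_powr ?Nt (1 / (1 - \<theta>)) \<le> ?N"
      unfolding Lp_norm_def[of p]
    proof (intro Inf_greatest, clarify)
      fix \<nu> :: real assume "0 < \<nu>" "modular p (\<lambda>x. indicator A x /\<^sub>R \<nu> :: real) \<le> 1"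
      then have "?Nt \<le> ennreal (\<nu> powr (1 - \<theta>))"
        using \<open>\<theta> < 1\<close> by (intro Lp_norm_le; (subst modular_eq)?) (simp_all add: powr_powr)
      then show "enn_powr ?Nt (1 / (1 - \<theta>)) \<le> ennreal \<nu>"
        using \<open>\<theta> < 1\<close> \<open>0 < \<nu>\<close> by (simp add: enn_powr_le_iff enn_powr_ennreal)
    qed
    then show "?Nt \<le> enn_powr ?N (1 - \<theta>)"
      using \<open>\<theta> < 1\<close> by (simp add: enn_powr_le_iff)
    show "enn_powr ?N (1 - \<theta>) \<le> ?Nt"
      unfolding Lp_norm_def[of pt]
    proof (intro Inf_greatest, clarify)
      fix \<mu> :: real assume "0 < \<mu>" "modular pt (\<lambda>x. indicator A x /\<^sub>R \<mu> :: real) \<le> 1"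
      then have "?N \<le> ennreal (\<mu> powr (1 / (1 - \<theta>)))"
        using modular_eq[OF \<open>0 < \<mu>\<close>] by (intro Lp_norm_le) simp_all
      then show "enn_powr ?N (1 - \<theta>) \<le> ennreal \<mu>"
        using \<open>\<theta> < 1\<close> \<open>0 < \<mu>\<close> by (simp add: enn_powr_le_iff enn_powr_ennreal)
    qed
  qed
qed

section \<open>The quasi-norm with variable second exponent\<close>

lemma exponents_AE_lower_bound:
  assumes "q0 \<in> exponents"
  obtains r :: real where "0 < r" "AE x in lebesgue. ennreal r \<le> q0 x"
proof -
  have "0 < essinf lebesgue q0" using assms by (simp add: exponents_def)
  then obtain z where z: "0 < z" "AE x in lebesgue. z \<le> q0 x"
    unfolding essinf_def less_Sup_iff by auto
  have "ennreal (enn2real (min z 1)) = min z 1"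
    by (cases z) (auto simp: min_def top_unique)
  moreover have "0 < min z 1" using z by simp
  ultimately have "0 < enn2real (min z 1)" "ennreal (enn2real (min z 1)) \<le> z"
    by (metis ennreal_0 enn2real_nonneg order_less_le, simp)
  then show ?thesis
    using z by (intro that[of "enn2real (min z 1)"]) (auto elim: eventually_mono)
qed

lemma root_exp_le:
  assumes "0 < \<nu>" "\<nu> \<le> 2" "0 < r" "ennreal r \<le> q"
  shows "root_exp \<nu> q \<le> 2 powr (1 / r)"
proof (cases q)
  case (real c)
  then have "r \<le> c" using assms by simp
  have "\<nu> powr (1 / c) \<le> 2 powr (1 / c)"
    using assms \<open>r \<le> c\<close> by (intro powr_mono2) auto
  also have "\<dots> \<le> 2 powr (1 / r)"
    using assms \<open>r \<le> c\<close> by (intro powr_mono) (auto simp: frac_le)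
  finally show ?thesis using real by (simp add: root_exp_def)
qed (use assms in \<open>simp add: root_exp_def ge_one_powr_ge_zero\<close>)

lemma root_exp_ge:
  assumes "0 < \<nu>" "\<nu> \<le> 1" "0 < r" "ennreal r \<le> q"
  shows "\<nu> powr (1 / r) \<le> root_exp \<nu> q"
proof (cases q)
  case (real c)
  then have "r \<le> c" using assms by simp
  then have "\<nu> powr (1 / r) \<le> \<nu> powr (1 / c)"
    using assms by (intro powr_mono') (auto simp: frac_le)
  then show ?thesis using real by (simp add: root_exp_def)
qed (use assms in \<open>simp add: root_exp_def powr_le1\<close>)

lemma root_exp_pos: "0 < \<nu> \<Longrightarrow> 0 < root_exp \<nu> q"
  by (simp add: root_exp_def)

lemma two_powi_floor_log:
  assumes "0 < (y::real)"
  obtains k :: int where "2 powi k \<le> y" "y < 2 * 2 powi k"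
proof (rule that[of "\<lfloor>log 2 y\<rfloor>"])
  have "(2::real) powi \<lfloor>log 2 y\<rfloor> = 2 powr of_int \<lfloor>log 2 y\<rfloor>" by (simp add: powr_real_of_int')
  moreover have "(2::real) powr of_int \<lfloor>log 2 y\<rfloor> \<le> 2 powr (log 2 y)" by (intro powr_mono) auto
  moreover have "(2::real) powr (log 2 y) < 2 powr (of_int \<lfloor>log 2 y\<rfloor> + 1)" by (intro powr_less_mono) linarith+
  ultimately show "2 powi \<lfloor>log 2 y\<rfloor> \<le> y" "y < 2 * 2 powi \<lfloor>log 2 y\<rfloor>"
    using assms by (simp_all add: powr_add)
qed

text \<open>
  The embedding of \<open>L\<^bsub>p,q\<^sub>0\<^esub>\<close> into the weak space \<open>L\<^bsub>p,\<infinity>\<^esub>\<close>: if the series defining the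
  quasi-norm is at most \<open>1\<close>, then so is each single term, and the level \<open>s\<close> differs from a dyadic
  one by a factor at most \<open>2\<close>. The lower bound \<open>r\<close> of \<open>q\<^sub>0\<close> keeps the weight \<open>\<nu>\<^bsup>1 / q\<^sub>0(x)\<^esup>\<close> bounded
  uniformly in \<open>x\<close>.
\<close>
lemma superlevel_norm_le_var_lorentz_norm:
  assumes "0 < r" and q0: "AE x in lebesgue. ennreal r \<le> q0 x" and "0 < s"
  shows "ennreal s * superlevel_norm p g s \<le> ennreal (2 * 2 powr (1 / r)) * var_lorentz_norm p q0 g"
proof -
  define C where "C = 2 * 2 powr (1 / r)"
  have "C > 0" by (simp add: C_def)
  have "ennreal (1 / C) * (ennreal s * superlevel_norm p g s) \<le> var_lorentz_norm p q0 g"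
    unfolding var_lorentz_norm_def
  proof (intro Inf_greatest, clarify)
    fix \<mu> :: real
    let ?E = "\<lambda>k x. 2 powi k * indicator {y. norm (g y / of_real \<mu>) > 2 powi k} x :: real"
    assume \<mu>: "0 < \<mu>" "mixed_modular q0 p ?E \<le> 1"
    obtain k where k: "2 powi k \<le> s / \<mu>" "s / \<mu> < 2 * 2 powi k"
      using two_powi_floor_log[of "s / \<mu>"] \<mu> \<open>0 < s\<close> by auto
    define T where "T = (\<lambda>k. Inf {ennreal \<nu> | \<nu>. 0 < \<nu> \<and> modular p (\<lambda>x. ?E k x /\<^sub>R root_exp \<nu> (q0 x)) \<le> 1})"
    have "T k = infsum T {k}" by simp
    also have "\<dots> \<le> infsum T UNIV" by (intro infsum_mono_neutral summable_on_ennreal_any) auto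
    also have "\<dots> \<le> 1" using \<mu>(2) by (simp add: mixed_modular_def T_def)
    \<comment> \<open>The infimum \<open>T k\<close> need not be attained; any bound above \<open>1\<close> gives an admissible \<open>\<nu>\<close>.\<close>
    also have "\<dots> < ennreal 2" by (simp flip: ennreal_1)
    finally obtain \<nu> where \<nu>: "0 < \<nu>" "\<nu> < 2" "modular p (\<lambda>x. ?E k x /\<^sub>R root_exp \<nu> (q0 x)) \<le> 1"
      unfolding T_def Inf_less_iff by (auto simp: ennreal_less_iff)
    define c where "c = 2 powr (1 / r) / 2 powi k"
    have "c > 0" by (simp add: c_def)
    have "modular p (\<lambda>x. indicator {x. norm (g x) > s} x /\<^sub>R c :: real)
        \<le> modular p (\<lambda>x. ?E k x /\<^sub>R root_exp \<nu> (q0 x))"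
    proof (rule modular_mono_AE)
      show "AE x in lebesgue. norm (indicator {x. norm (g x) > s} x /\<^sub>R c :: real)
          \<le> norm (?E k x /\<^sub>R root_exp \<nu> (q0 x))"
        using q0
      proof eventually_elim
        case (elim x)
        show ?case
        proof (cases "norm (g x) > s")
          case True
          then have "2 powi k < norm (g x / of_real \<mu>)"
            using k(1) \<mu>(1) by (simp add: norm_divide) (smt (verit) divide_strict_right_mono)
          moreover have "inverse (root_exp \<nu> (q0 x)) \<ge> inverse (2 powr (1 / r))"
            using root_exp_le[OF \<nu>(1) _ \<open>0 < r\<close> elim] root_exp_pos[OF \<nu>(1)] \<nu>(2)
            by (intro le_imp_inverse_le) auto
          ultimately show ?thesis
            using True root_exp_pos[OF \<nu>(1), of "q0 x"]
            by (simp add: c_def divide_inverse abs_mult power_int_minus)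
        qed simp
      qed
    qed
    then have "superlevel_norm p g s \<le> ennreal c"
      unfolding superlevel_norm_def using \<nu>(3) \<open>c > 0\<close> by (intro Lp_norm_le) auto
    then have "ennreal (1 / C) * (ennreal s * superlevel_norm p g s)
        \<le> ennreal (1 / C) * (ennreal s * ennreal c)"
      by (intro mult_left_mono) auto
    also have "\<dots> = ennreal (1 / C * (s * c))"
      using \<open>C > 0\<close> \<open>c > 0\<close> \<open>0 < s\<close> by (simp flip: ennreal_mult)
    also have "\<dots> \<le> ennreal \<mu>"
      using k(2) \<mu>(1) by (intro ennreal_leI) (simp add: C_def c_def field_simps)
    finally show "ennreal (1 / C) * (ennreal s * superlevel_norm p g s) \<le> ennreal \<mu>" .
  qed
  then have "ennreal C * (ennreal (1 / C) * (ennreal s * superlevel_norm p g s))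
      \<le> ennreal C * var_lorentz_norm p q0 g"
    by (rule mult_left_mono) simp
  moreover have "ennreal C * (ennreal (1 / C) * (ennreal s * superlevel_norm p g s))
      = ennreal s * superlevel_norm p g s"
    using \<open>C > 0\<close> by (simp flip: mult.assoc ennreal_mult)
  ultimately show ?thesis by (simp add: C_def)
qed

text \<open>
  The embedding of \<open>L\<^bsub>p,r\<^esub>\<close> with constant exponent \<open>r\<close> into \<open>L\<^bsub>p,q\<^sub>0\<^esub>\<close>: the number
  \<open>\<nu> = (2\<^sup>k b\<^sub>k)\<^sup>r\<close> is at most \<open>1\<close>, hence \<open>\<nu>\<^bsup>1 / q\<^sub>0(x)\<^esup> \<ge> \<nu>\<^bsup>1 / r\<^esup> = 2\<^sup>k b\<^sub>k\<close>, which makes \<open>\<nu>\<close>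
  admissible in the \<open>k\<close>-th infimum.
\<close>
lemma var_lorentz_norm_le:
  assumes "0 < r" and q0: "AE x in lebesgue. ennreal r \<le> q0 x" and "0 < \<mu>"
    and b: "\<And>k. 0 < b k" "\<And>k. superlevel_norm p g (2 powi k * \<mu>) < ennreal (b k)"
    and sum: "(\<Sum>\<^sub>\<infinity>k. ennreal ((2 powi k * b k) powr r)) \<le> 1"
  shows "var_lorentz_norm p q0 g \<le> ennreal \<mu>"
proof -
  let ?E = "\<lambda>k x. 2 powi k * indicator {y. norm (g y / of_real \<mu>) > 2 powi k} x :: real"
  have "mixed_modular q0 p ?E \<le> (\<Sum>\<^sub>\<infinity>k. ennreal ((2 powi k * b k) powr r))"
    unfolding mixed_modular_def
  proof (intro infsum_mono summable_on_ennreal_any)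
    fix k :: int
    define \<nu> where "\<nu> = (2 powi k * b k) powr r"
    have "2 powi k * b k > 0" using b(1)[of k] by simp
    then have "0 < \<nu>" using b(1)[of k] by (simp add: \<nu>_def)
    have "ennreal \<nu> = (\<Sum>\<^sub>\<infinity>j\<in>{k}. ennreal ((2 powi j * b j) powr r))" by (simp add: \<nu>_def)
    also have "\<dots> \<le> (\<Sum>\<^sub>\<infinity>k. ennreal ((2 powi k * b k) powr r))" by (intro infsum_mono_neutral summable_on_ennreal_any) auto
    also have "\<dots> \<le> 1" by (rule sum)
    finally have "\<nu> \<le> 1" by simp
    have \<nu>_root: "\<nu> powr (1 / r) = 2 powi k * b k"
      using \<open>2 powi k * b k > 0\<close> \<open>0 < r\<close> b(1)[of k] by (simp add: \<nu>_def powr_powr)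
    have "modular p (\<lambda>x. ?E k x /\<^sub>R root_exp \<nu> (q0 x))
        \<le> modular p (\<lambda>x. indicator {x. norm (g x) > 2 powi k * \<mu>} x /\<^sub>R b k :: real)"
    proof (rule modular_mono_AE)
      show "AE x in lebesgue. norm (?E k x /\<^sub>R root_exp \<nu> (q0 x))
          \<le> norm (indicator {x. norm (g x) > 2 powi k * \<mu>} x /\<^sub>R b k :: real)"
        using q0
      proof eventually_elim
        case (elim x)
        have "inverse (root_exp \<nu> (q0 x)) \<le> inverse (2 powi k * b k)"
          using root_exp_ge[OF \<open>0 < \<nu>\<close> \<open>\<nu> \<le> 1\<close> \<open>0 < r\<close> elim] \<open>2 powi k * b k > 0\<close>
          by (intro le_imp_inverse_le) (auto simp: \<nu>_root)
        then have "2 powi k * inverse (root_exp \<nu> (q0 x)) \<le> 2 powi k * inverse (2 powi k * b k)"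
          by (rule mult_left_mono) simp
        then show ?case
          using root_exp_pos[OF \<open>0 < \<nu>\<close>, of "q0 x"] b(1)[of k] \<open>0 < \<mu>\<close>
          by (auto simp: norm_divide field_simps split: split_indicator)
      qed
    qed
    also have "\<dots> \<le> 1"
      using b(2)[of k] unfolding superlevel_norm_def by (rule modular_le_1_of_Lp_norm_less)
    finally show "Inf {ennreal \<nu> | \<nu>. 0 < \<nu> \<and> modular p (\<lambda>x. ?E k x /\<^sub>R root_exp \<nu> (q0 x)) \<le> 1}
        \<le> ennreal ((2 powi k * b k) powr r)"
      using \<open>0 < \<nu>\<close> unfolding \<nu>_def by (intro Inf_lower) auto
  qed
  then show ?thesis
    unfolding var_lorentz_norm_def using sum \<open>0 < \<mu>\<close> by (intro Inf_lower) auto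
qed

lemma infsum_geometric_int_le:
  assumes "0 \<le> \<rho>" "\<rho> < 1"
  shows "(\<Sum>\<^sub>\<infinity>k::int. ennreal (\<rho> ^ nat \<bar>k\<bar>)) \<le> ennreal (2 / (1 - \<rho>))"
proof -
  have part: "(\<Sum>k\<in>F. \<rho> ^ nat \<bar>k\<bar>) \<le> 1 / (1 - \<rho>)"
    if "finite F" "inj_on (\<lambda>k. nat \<bar>k\<bar>) F" for F :: "int set"
  proof -
    have "(\<Sum>k\<in>F. \<rho> ^ nat \<bar>k\<bar>) = (\<Sum>n\<in>(\<lambda>k. nat \<bar>k\<bar>) ` F. \<rho> ^ n)"
      using that by (simp add: sum.reindex)
    also have "\<dots> \<le> (\<Sum>n. \<rho> ^ n)"
      using that assms by (intro sum_le_suminf) (auto intro!: summable_geometric)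
    also have "\<dots> = 1 / (1 - \<rho>)" using assms by (simp add: suminf_geometric)
    finally show ?thesis .
  qed
  show ?thesis
  proof (subst nonneg_infsum_complete, simp, intro SUP_least, clarify)
    fix F :: "int set" assume "finite F"
    have "(\<Sum>k\<in>F. \<rho> ^ nat \<bar>k\<bar>) = (\<Sum>k\<in>F \<inter> {0..}. \<rho> ^ nat \<bar>k\<bar>) + (\<Sum>k\<in>F \<inter> {..<0}. \<rho> ^ nat \<bar>k\<bar>)"
      using \<open>finite F\<close> by (subst sum.union_disjoint[symmetric]) (auto intro!: sum.cong)
    also have "\<dots> \<le> 1 / (1 - \<rho>) + 1 / (1 - \<rho>)"
      using \<open>finite F\<close> by (intro add_mono part) (auto simp: inj_on_def)
    finally show "(\<Sum>k\<in>F. ennreal (\<rho> ^ nat \<bar>k\<bar>)) \<le> ennreal (2 / (1 - \<rho>))"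
      using assms by (simp add: sum_ennreal ennreal_leI)
  qed
qed

section \<open>Bounds for the K-functional\<close>

text \<open>
  In a decomposition \<open>f = g + h\<close> either \<open>h\<close> is at least \<open>s / 2\<close> in \<open>L\<^sub>\<infinity>\<close>, which costs
  \<open>t s / 2\<close>, or \<open>\<bar>g\<bar> > s / 2\<close> wherever \<open>\<bar>f\<bar> > s\<close>, and then the weak estimate gives \<open>g\<close> a norm of
  order \<open>s t\<close>, because the superlevel set of \<open>f\<close> has norm at least \<open>t\<close>.
\<close>
lemma K_functional_lower_bound:
  assumes "0 < r" and q0: "AE x in lebesgue. ennreal r \<le> q0 x"
    and "0 < s" "0 < t" and D: "ennreal t \<le> superlevel_norm p f s"
  shows "ennreal (s * t) \<le> ennreal (4 * 2 powr (1 / r)) * K_functional (var_lorentz p q0) L_infty f t"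
proof -
  define C where "C = 2 * 2 powr (1 / r)"
  have "C \<ge> 1" using \<open>0 < r\<close> ge_one_powr_ge_zero[of 2 "1 / r"] by (simp add: C_def)
  have "ennreal (s * t / (2 * C)) \<le> K_functional (var_lorentz p q0) L_infty f t"
    unfolding K_functional_def
  proof (intro Inf_greatest, clarify)
    fix g h assume h: "h \<in> fst L_infty" and f: "AE x in lebesgue. f x = g x + h x"
    let ?N = "snd (var_lorentz p q0) g" and ?H = "snd L_infty h"
    show "ennreal (s * t / (2 * C)) \<le> ?N + ennreal t * ?H"
    proof (cases "ennreal (s / 2) \<le> ?H")
      case True
      have "s * t / (2 * C) \<le> t * (s / 2)"
        using \<open>C \<ge> 1\<close> \<open>0 < s\<close> \<open>0 < t\<close> by (simp add: field_simps mult_le_cancel_left1)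
      then have "ennreal (s * t / (2 * C)) \<le> ennreal t * ennreal (s / 2)"
        using \<open>0 < t\<close> \<open>0 < s\<close> by (simp add: ennreal_leI flip: ennreal_mult)
      also have "\<dots> \<le> ennreal t * ?H" using True by (rule mult_left_mono) simp
      finally show ?thesis by (simp add: add_increasing)
    next
      case False
      have "AE x in lebesgue. ennreal (norm (h x)) \<le> ?H"
        using esssup_AE[of _ lebesgue] by (simp add: L_infty_def space_of_norm_def)
      then have "AE x in lebesgue. s < norm (f x) \<longrightarrow> s / 2 < norm (g x)"
        using f
      proof eventually_elim
        case (elim x)
        then have "ennreal (norm (h x)) < ennreal (s / 2)" using False by (simp add: not_le)
        then have "norm (h x) < s / 2" by (simp add: ennreal_less_iff)
        then show ?case using elim(2) norm_triangle_ineq[of "g x" "h x"] by auto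
      qed
      then have "ennreal t \<le> superlevel_norm p g (s / 2)"
        using D superlevel_norm_mono_AE order_trans by blast
      then have "ennreal (s / 2) * ennreal t \<le> ennreal (s / 2) * superlevel_norm p g (s / 2)"
        by (rule mult_left_mono) simp
      also have "\<dots> \<le> ennreal C * ?N"
        using superlevel_norm_le_var_lorentz_norm[OF assms(1,2), of "s / 2" p g] \<open>0 < s\<close>
        by (simp add: C_def var_lorentz_def space_of_norm_def)
      finally have "ennreal (1 / C) * (ennreal (s / 2) * ennreal t) \<le> ennreal (1 / C) * (ennreal C * ?N)"
        by (rule mult_left_mono) simp
      also have "\<dots> = ?N" using \<open>C \<ge> 1\<close> by (simp flip: mult.assoc ennreal_mult)
      also have "ennreal (1 / C) * (ennreal (s / 2) * ennreal t) = ennreal (s * t / (2 * C))"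
        using \<open>C \<ge> 1\<close> \<open>0 < s\<close> \<open>0 < t\<close> by (simp add: mult_ac flip: ennreal_mult)
      finally show ?thesis by (simp add: add_increasing2)
    qed
  qed
  then have "ennreal (2 * C) * ennreal (s * t / (2 * C))
      \<le> ennreal (2 * C) * K_functional (var_lorentz p q0) L_infty f t"
    by (rule mult_left_mono) simp
  moreover have "ennreal (2 * C) * ennreal (s * t / (2 * C)) = ennreal (s * t)"
    using \<open>C \<ge> 1\<close> \<open>0 < s\<close> \<open>0 < t\<close> by (simp flip: ennreal_mult)
  ultimately show ?thesis by (simp add: C_def)
qed

lemma K_functional_truncation_le:
  assumes f [measurable]: "f \<in> borel_measurable lebesgue" and "0 < s" "0 < t" "0 \<le> \<mu>"
    and N: "var_lorentz_norm p q0 (\<lambda>x. if s < norm (f x) then f x else 0) \<le> ennreal \<mu>"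
  shows "K_functional (var_lorentz p q0) L_infty f t \<le> ennreal (\<mu> + t * s)"
proof -
  define g where "g = (\<lambda>x. if s < norm (f x) then f x else 0)"
  define h where "h = (\<lambda>x. if s < norm (f x) then 0 else f x)"
  have [measurable]: "g \<in> borel_measurable lebesgue" "h \<in> borel_measurable lebesgue"
    unfolding g_def h_def by measurable
  have Ng: "var_lorentz_norm p q0 g \<le> ennreal \<mu>" using N by (simp add: g_def)
  have Nh: "esssup lebesgue (\<lambda>x. ennreal (norm (h x))) \<le> ennreal s"
    by (intro esssup_I always_eventually) (auto simp: h_def ennreal_leI)
  have "K_functional (var_lorentz p q0) L_infty f t
      \<le> snd (var_lorentz p q0) g + ennreal t * snd L_infty h"
    unfolding K_functional_def
  proof (intro Inf_lower CollectI exI conjI)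
    show "g \<in> fst (var_lorentz p q0)"
      using le_less_trans[OF Ng] by (simp add: var_lorentz_def space_of_norm_def)
    show "h \<in> fst L_infty"
      using le_less_trans[OF Nh] by (simp add: L_infty_def space_of_norm_def)
    show "AE x in lebesgue. f x = g x + h x"
      by (intro always_eventually) (simp add: g_def h_def)
  qed simp
  also have "\<dots> \<le> ennreal \<mu> + ennreal t * ennreal s"
    using Ng Nh by (intro add_mono mult_left_mono) (simp_all add: var_lorentz_def L_infty_def space_of_norm_def)
  also have "\<dots> = ennreal (\<mu> + t * s)"
    using assms by (simp flip: ennreal_mult ennreal_plus)
  finally show ?thesis .
qed

text \<open>
  The summand of the dyadic series met below: it decays geometrically in both directions, like
  \<open>2\<^bsup>j r\<^esup>\<close> for negative \<open>j\<close> and like \<open>2\<^bsup>(1 - a) j r\<^esup>\<close> for positive \<open>j\<close>.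
\<close>
lemma two_powi_decay:
  fixes r a :: real
  assumes "0 < r" "1 < a"
  shows "(2 powi j * min 1 ((2 powi j) powr (- a))) powr r
         \<le> max (2 powr (- r)) (2 powr ((1 - a) * r)) ^ nat \<bar>j\<bar>"
proof -
  let ?\<rho> = "max (2 powr (- r)) (2 powr ((1 - a) * r))"
  have powi: "(2::real) powi j = 2 powr of_int j" by (simp add: powr_real_of_int')
  have pos: "0 < ?\<rho>" by (simp add: less_max_iff_disj)
  show ?thesis
  proof (cases "0 \<le> j")
    case True
    have "(2 powi j * min 1 ((2 powi j) powr (- a))) powr r \<le> (2 powi j * (2 powi j) powr (- a)) powr r"
      using assms by (intro powr_mono2 mult_left_mono) auto
    also have "\<dots> = (2 powr ((1 - a) * r)) powr of_int j"
      by (simp add: powi powr_powr algebra_simps flip: powr_add)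
    also have "\<dots> \<le> ?\<rho> powr of_int j" using True by (intro powr_mono2) auto
    also have "\<dots> = ?\<rho> ^ nat \<bar>j\<bar>" using True pos by (simp flip: powr_realpow)
    finally show ?thesis .
  next
    case False
    have "(2 powi j * min 1 ((2 powi j) powr (- a))) powr r \<le> (2 powi j * 1) powr r"
      using assms by (intro powr_mono2 mult_left_mono) auto
    also have "\<dots> = (2 powr (- r)) powr of_int (- j)"
      by (simp add: powi powr_powr algebra_simps)
    also have "\<dots> \<le> ?\<rho> powr of_int (- j)" using False by (intro powr_mono2) auto
    also have "\<dots> = ?\<rho> ^ nat \<bar>j\<bar>" using False pos by (simp flip: powr_realpow)
    finally show ?thesis .
  qed
qed

text \<open>
  By the hypothesis on \<open>m\<close>, the norm of \<open>{\<bar>f\<bar> > s}\<close>, where it is below \<open>t\<close>, is at most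
  \<open>(m / s)\<^bsup>a\<^esup>\<close> with \<open>a = 1 / (1 - \<epsilon>) > 1\<close>. Cut \<open>f\<close> at the height \<open>s\<close> where this
  bound reaches the order of \<open>t\<close>. The bounded part costs \<open>t s\<close>, which is of order \<open>t\<^bsup>\<epsilon>\<^esup> m\<close>. Because
  \<open>a > 1\<close>, the dyadic series for the large part decays geometrically on both sides of the level \<open>s\<close>
  and gives the same order, for every lower bound \<open>r\<close> of the second exponent.
\<close>
lemma K_functional_upper_bound:
  assumes "0 < r" and q0: "AE x in lebesgue. ennreal r \<le> q0 x" and \<epsilon>: "0 < \<epsilon>" "\<epsilon> < 1"
  shows "\<exists>C>0. \<forall>f\<in>borel_measurable lebesgue. \<forall>t>0. \<forall>m.
     (\<forall>s>0. ennreal s * enn_powr (min (superlevel_norm p f s) (ennreal t)) (1 - \<epsilon>) \<le> m)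
     \<longrightarrow> K_functional (var_lorentz p q0) L_infty f t \<le> ennreal C * (ennreal (t powr \<epsilon>) * m)"
proof -
  define a where "a = 1 / (1 - \<epsilon>)"
  have "a > 1" using \<epsilon> by (simp add: a_def)
  define \<rho> where "\<rho> = max (2 powr (- r)) (2 powr ((1 - a) * r))"
  have "2 powr (- r) < 2 powr 0" "2 powr ((1 - a) * r) < 2 powr (0::real)"
    using \<open>0 < r\<close> \<open>a > 1\<close> by (intro powr_less_mono; simp add: mult_neg_pos)+
  then have \<rho>: "0 \<le> \<rho>" "\<rho> < 1" by (auto simp: \<rho>_def le_max_iff_disj)
  \<comment> \<open>\<open>V\<close> bounds the sum of the dyadic series; scaling by \<open>c\<close> brings it down to \<open>1\<close>.\<close>
  define V where "V = 2 / (1 - \<rho>)"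
  have "V > 0" using \<rho> by (simp add: V_def)
  define c where "c = V powr (1 / r)"
  have "c > 0" using \<open>V > 0\<close> by (simp add: c_def)
  have finite_bound: "K_functional (var_lorentz p q0) L_infty f t \<le> ennreal ((4 * c + 2) * (t powr \<epsilon> * m))"
    if f: "f \<in> borel_measurable lebesgue" and "0 < t" "0 < m"
      and m: "\<And>s. 0 < s \<Longrightarrow> ennreal s * enn_powr (min (superlevel_norm p f s) (ennreal t)) (1 - \<epsilon>) \<le> ennreal m"
    for f t m
  proof -
    \<comment> \<open>The factor \<open>2\<close> makes \<open>(m / s) powr a\<close> strictly smaller than \<open>t\<close>.\<close>
    define s where "s = 2 * m / t powr (1 - \<epsilon>)"
    have "s > 0" using \<open>0 < t\<close> \<open>0 < m\<close> by (simp add: s_def)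
    have ts: "t * s = 2 * (t powr \<epsilon> * m)"
      using \<open>0 < t\<close> by (simp add: s_def powr_diff)
    have decay: "superlevel_norm p f u < ennreal (t * (u / s) powr (- a))" if "s \<le> u" for u
    proof -
      have "u > 0" using that \<open>s > 0\<close> by simp
      have "ennreal (1 / u) * (ennreal u * enn_powr (min (superlevel_norm p f u) (ennreal t)) (1 - \<epsilon>))
          \<le> ennreal (1 / u) * ennreal m"
        using m[OF \<open>u > 0\<close>] by (rule mult_left_mono) simp
      then have "enn_powr (min (superlevel_norm p f u) (ennreal t)) (1 - \<epsilon>) \<le> ennreal (m / u)"
        using \<open>u > 0\<close> \<open>0 < m\<close> by (simp flip: mult.assoc ennreal_mult)
      then have *: "min (superlevel_norm p f u) (ennreal t) \<le> ennreal ((m / u) powr a)"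
        using \<epsilon> \<open>u > 0\<close> \<open>0 < m\<close> by (simp add: enn_powr_le_iff enn_powr_ennreal a_def)
      have "m / u = t powr (1 - \<epsilon>) * ((u / s) powr (-1) * (1 / 2))"
        using \<open>0 < t\<close> \<open>u > 0\<close> \<open>s > 0\<close> \<open>0 < m\<close> by (simp add: s_def powr_minus field_simps)
      then have "(m / u) powr a = (t powr (1 - \<epsilon>)) powr a * (((u / s) powr (-1)) powr a * (1 / 2) powr a)"
        using \<open>u > 0\<close> \<open>s > 0\<close> by (simp only: powr_mult)
      also have "\<dots> = t powr ((1 - \<epsilon>) * a) * ((u / s) powr (-1 * a) * (1 / 2) powr a)"
        by (simp only: powr_powr)
      also have "\<dots> = t * (u / s) powr (- a) * (1 / 2) powr a"
        using \<open>0 < t\<close> \<epsilon> by (simp add: a_def)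
      also have "\<dots> < t * (u / s) powr (- a) * 1"
        using \<open>0 < t\<close> \<open>u > 0\<close> \<open>s > 0\<close> \<open>a > 1\<close> powr_less_mono2[of a "1 / 2" 1]
        by (intro mult_strict_left_mono) auto
      finally have less: "(m / u) powr a < t * (u / s) powr (- a)" by simp
      also have "\<dots> \<le> t * 1"
        using \<open>0 < t\<close> that \<open>s > 0\<close> \<open>a > 1\<close> powr_mono2'[of "- a" 1 "u / s"]
        by (intro mult_left_mono) auto
      finally have "ennreal ((m / u) powr a) < ennreal t"
        using \<open>0 < t\<close> by (simp add: ennreal_lessI)
      with * have "superlevel_norm p f u \<le> ennreal ((m / u) powr a)"
        by (metis min_def leD)
      also have "\<dots> < ennreal (t * (u / s) powr (- a))"
        using less \<open>0 < t\<close> \<open>u > 0\<close> \<open>s > 0\<close> by (intro ennreal_lessI) auto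
      finally show ?thesis .
    qed
    \<comment> \<open>The norm of the large part is bounded by \<open>\<mu> = 2 powi i * s\<close>, of order \<open>c t s\<close>. Taking \<open>\<mu> / s\<close> as a
      power of \<open>2\<close> aligns the dyadic levels \<open>2 powi k * \<mu>\<close> with those based at \<open>s\<close>.\<close>
    obtain i where i: "2 powi i \<le> 2 * (c * t)" "2 * (c * t) < 2 * 2 powi i"
      using two_powi_floor_log[of "2 * (c * t)"] \<open>c > 0\<close> \<open>0 < t\<close> by auto
    define g where "g = (\<lambda>x. if s < norm (f x) then f x else 0)"
    define w where "w = (\<lambda>j::int. min 1 ((2 powi j) powr (- a)))"
    have "w j > 0" for j by (simp add: w_def)
    have "var_lorentz_norm p q0 g \<le> ennreal (2 powi i * s)"
    proof (rule var_lorentz_norm_le[OF \<open>0 < r\<close> q0])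
      show "0 < 2 powi i * s" using \<open>s > 0\<close> by simp
      fix k :: int
      show "0 < t * w (k + i)" using \<open>0 < t\<close> \<open>w (k + i) > 0\<close> by simp
      have not_neg: "\<not> (2::real) powi j < 0" for j by (simp add: not_less)
      let ?u = "max s (2 powi (k + i) * s)"
      have "superlevel_norm p g (2 powi k * (2 powi i * s)) \<le> superlevel_norm p f ?u"
        by (intro superlevel_norm_mono_AE always_eventually)
           (use \<open>s > 0\<close> in \<open>auto simp: g_def power_int_add mult_ac mult_less_0_iff not_neg split: if_splits\<close>)
      also have "\<dots> < ennreal (t * (?u / s) powr (- a))" by (rule decay) simp
      also have "?u / s = max 1 (2 powi (k + i))" using \<open>s > 0\<close> by (simp add: max_def)
      also have "max 1 (2 powi (k + i)) powr (- a) = w (k + i)"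
        using \<open>a > 1\<close> powr_mono2'[of "- a" 1 "2 powi (k + i)"] powr_mono2'[of "- a" "2 powi (k + i)" 1]
        by (auto simp: w_def max_def min_def)
      finally show "superlevel_norm p g (2 powi k * (2 powi i * s)) < ennreal (t * w (k + i))" .
    next
      have "(\<Sum>\<^sub>\<infinity>k. ennreal ((2 powi k * (t * w (k + i))) powr r))
          \<le> (\<Sum>\<^sub>\<infinity>k. ennreal (1 / V) * ennreal (\<rho> ^ nat \<bar>k + i\<bar>))"
      proof (intro infsum_mono summable_on_ennreal_any)
        fix k :: int
        have "2 powi k * (t * w (k + i)) = t / 2 powi i * (2 powi (k + i) * w (k + i))"
          by (simp add: power_int_add)
        also have "\<dots> \<le> 1 / c * (2 powi (k + i) * w (k + i))"
          using i(2) \<open>c > 0\<close> \<open>w (k + i) > 0\<close> by (intro mult_right_mono) (simp_all add: field_simps)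
        finally have "(2 powi k * (t * w (k + i))) powr r \<le> (1 / c * (2 powi (k + i) * w (k + i))) powr r"
          using \<open>0 < t\<close> \<open>0 < r\<close> \<open>w (k + i) > 0\<close> by (intro powr_mono2) auto
        also have "\<dots> = (1 / c) powr r * (2 powi (k + i) * w (k + i)) powr r"
          using \<open>c > 0\<close> \<open>w (k + i) > 0\<close> by (intro powr_mult)
        also have "\<dots> \<le> 1 / V * \<rho> ^ nat \<bar>k + i\<bar>"
          using \<open>V > 0\<close> \<open>0 < r\<close> two_powi_decay[OF \<open>0 < r\<close> \<open>a > 1\<close>, of "k + i"]
          by (intro mult_mono) (simp_all add: c_def \<rho>_def w_def powr_divide powr_powr)
        finally show "ennreal ((2 powi k * (t * w (k + i))) powr r) \<le> ennreal (1 / V) * ennreal (\<rho> ^ nat \<bar>k + i\<bar>)"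
          using \<open>V > 0\<close> \<rho> by (simp add: ennreal_leI flip: ennreal_mult)
      qed
      also have "\<dots> = ennreal (1 / V) * (\<Sum>\<^sub>\<infinity>k. ennreal (\<rho> ^ nat \<bar>k + i\<bar>))"
        by (rule infsum_cmult_ennreal)
      also have "(\<Sum>\<^sub>\<infinity>k. ennreal (\<rho> ^ nat \<bar>k + i\<bar>)) = (\<Sum>\<^sub>\<infinity>k. ennreal (\<rho> ^ nat \<bar>k\<bar>))"
        by (rule infsum_reindex_bij_betw) (rule bij_betw_byWitness[where f' = "\<lambda>k. k - i"], auto)
      also have "ennreal (1 / V) * \<dots> \<le> ennreal (1 / V) * ennreal V"
        unfolding V_def by (intro mult_left_mono infsum_geometric_int_le \<rho>) simp
      also have "\<dots> = 1" using \<open>V > 0\<close> by (simp flip: ennreal_mult)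
      finally show "(\<Sum>\<^sub>\<infinity>k. ennreal ((2 powi k * (t * w (k + i))) powr r)) \<le> 1" .
    qed
    then have "K_functional (var_lorentz p q0) L_infty f t \<le> ennreal (2 powi i * s + t * s)"
      using \<open>s > 0\<close> \<open>0 < t\<close> f unfolding g_def by (intro K_functional_truncation_le) auto
    also have "2 powi i * s + t * s \<le> (2 * (c * t)) * s + t * s"
      using i(1) \<open>s > 0\<close> by (intro add_right_mono mult_right_mono) auto
    also have "\<dots> = (2 * c + 1) * (t * s)" by (simp add: algebra_simps)
    also have "\<dots> = (4 * c + 2) * (t powr \<epsilon> * m)" unfolding ts by (simp add: algebra_simps)
    finally show ?thesis by (simp add: ennreal_leI)
  qed
  define C where "C = 4 * c + 2"
  have "C > 0" using \<open>c > 0\<close> by (simp add: C_def)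
  show ?thesis
  proof (intro exI[of _ C] conjI ballI allI impI)
    show "0 < C" by fact
    fix f t m
    assume f: "f \<in> borel_measurable lebesgue" and "0 < (t::real)"
      and m: "\<forall>s>0. ennreal s * enn_powr (min (superlevel_norm p f s) (ennreal t)) (1 - \<epsilon>) \<le> m"
    show "K_functional (var_lorentz p q0) L_infty f t \<le> ennreal C * (ennreal (t powr \<epsilon>) * m)"
    proof (cases m)
      case top
      then show ?thesis using \<open>C > 0\<close> \<open>0 < t\<close> by (simp add: ennreal_mult_top)
    next
      case (real m0)
      show ?thesis
      proof (rule ennreal_le_epsilon)
        fix e :: real assume "0 < e"
        \<comment> \<open>The bound was obtained for positive \<open>m\<close> only; \<open>d\<close> is chosen to cost exactly \<open>e\<close>.\<close>
        define d where "d = e / (C * t powr \<epsilon>)"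
        have "d > 0" using \<open>0 < e\<close> \<open>C > 0\<close> \<open>0 < t\<close> by (simp add: d_def)
        have "ennreal s * enn_powr (min (superlevel_norm p f s) (ennreal t)) (1 - \<epsilon>) \<le> ennreal (m0 + d)"
          if "0 < s" for s
          using order_trans[OF m[rule_format, OF that], of "ennreal (m0 + d)"] real \<open>d > 0\<close> by (simp add: ennreal_leI)
        then have "K_functional (var_lorentz p q0) L_infty f t \<le> ennreal (C * (t powr \<epsilon> * (m0 + d)))"
          unfolding C_def using real \<open>d > 0\<close> by (intro finite_bound f \<open>0 < t\<close>) auto
        also have "C * (t powr \<epsilon> * (m0 + d)) = C * (t powr \<epsilon> * m0) + e"
          using \<open>C > 0\<close> \<open>0 < t\<close> by (simp add: d_def field_simps)
        also have "ennreal \<dots> = ennreal C * (ennreal (t powr \<epsilon>) * m) + ennreal e"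
          using \<open>C > 0\<close> \<open>0 < e\<close> real by (simp add: ennreal_mult)
        finally show "K_functional (var_lorentz p q0) L_infty f t
            \<le> ennreal C * (ennreal (t powr \<epsilon>) * m) + ennreal e" .
      qed
    qed
  qed
qed

section \<open>The interpolation theorem\<close>

lemma lorentz_norm_eq_Lq_star:
  "lorentz_norm p q f = Lq_star q (\<lambda>s. ennreal s * superlevel_norm p f s)"
  unfolding lorentz_norm_def Lq_star_def
  by (auto simp: enn_powr_mult enn_powr_ennreal split: split_indicator
      intro!: arg_cong[where f = "\<lambda>x. enn_powr x _"] nn_integral_cong)

lemma interp_norm_eq_Lq_star:
  "interp_norm X0 X1 \<theta> q f = Lq_star q (\<lambda>t. ennreal (t powr (- \<theta>)) * K_functional X0 X1 f t)"
  unfolding interp_norm_def Lq_star_def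
  by (auto simp: enn_powr_mult enn_powr_ennreal powr_powr split: split_indicator
      intro!: arg_cong[where f = "\<lambda>x. enn_powr x _"] nn_integral_cong)

lemma mono_K_functional: "mono (K_functional X0 X1 f)"
proof (rule monoI)
  fix s t :: real assume "s \<le> t"
  show "K_functional X0 X1 f s \<le> K_functional X0 X1 f t"
    unfolding K_functional_def
  proof (intro Inf_mono, clarify)
    fix g h assume "g \<in> fst X0" "h \<in> fst X1" "AE x in lebesgue. f x = g x + h x"
    then show "\<exists>y\<in>{snd X0 g + ennreal s * snd X1 h | g h.
        g \<in> fst X0 \<and> h \<in> fst X1 \<and> (AE x in lebesgue. f x = g x + h x)}.
        y \<le> snd X0 g + ennreal t * snd X1 h"
      using \<open>s \<le> t\<close>
      by (intro bexI[of _ "snd X0 g + ennreal s * snd X1 h"] add_left_mono mult_right_mono)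
         (auto simp: ennreal_leI)
  qed
qed

lemma sum_space_of_K_functional_finite:
  assumes "f \<in> borel_measurable lebesgue" "K_functional X0 X1 f t < \<infinity>"
  shows "f \<in> sum_space X0 X1"
  using assms by (auto simp: K_functional_def sum_space_def Inf_less_iff)

theorem theorem8:
  fixes p q0 pt :: "real ^ 'n \<Rightarrow> ennreal" and q :: ennreal and \<theta> :: real
  assumes "p \<in> exponents" and "q0 \<in> exponents"
    and "esssup lebesgue p < \<infinity>"
    and "0 < q" and "0 < \<theta>" and "\<theta> < 1"
    and "\<And>x. 1 / pt x = ennreal (1 - \<theta>) / p x"
  shows "equal_equiv_norms (real_interpolation (var_lorentz p q0) L_infty \<theta> q) (lorentz pt q)"
proof -
  let ?X = "var_lorentz p q0"
  let ?I = "interp_norm ?X L_infty \<theta> q" and ?L = "lorentz_norm pt q"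
  obtain r where r: "0 < r" "AE x in lebesgue. ennreal r \<le> q0 x"
    using exponents_AE_lower_bound[OF \<open>q0 \<in> exponents\<close>] .
  define c where "c = 4 * 2 powr (1 / r)"
  have "c > 0" by (simp add: c_def)
  have "0 < \<theta> / 2" "\<theta> / 2 < \<theta>" "\<theta> / 2 < 1" using assms by auto
  obtain A where "0 < A" and A: "\<forall>f\<in>borel_measurable lebesgue. \<forall>t>0. \<forall>m.
     (\<forall>s>0. ennreal s * enn_powr (min (superlevel_norm p f s) (ennreal t)) (1 - \<theta> / 2) \<le> m)
     \<longrightarrow> K_functional ?X L_infty f t \<le> ennreal A * (ennreal (t powr (\<theta> / 2)) * m)"
    using K_functional_upper_bound[OF r \<open>0 < \<theta> / 2\<close> \<open>\<theta> / 2 < 1\<close>, of p] by (elim exE conjE)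
  obtain B where "0 < B" and B: "\<forall>D K. antimono D \<longrightarrow> K \<in> borel_measurable borel \<longrightarrow>
     (\<forall>t>0. \<forall>m. (\<forall>s>0. ennreal s * enn_powr (min (D s) (ennreal t)) (1 - \<theta> / 2) \<le> m)
        \<longrightarrow> K t \<le> ennreal (t powr (\<theta> / 2)) * m) \<longrightarrow>
     Lq_star q (\<lambda>t. ennreal (t powr (- \<theta>)) * K t)
       \<le> ennreal B * Lq_star q (\<lambda>s. ennreal s * enn_powr (D s) (1 - \<theta>))"
    using Lq_star_le_of_upper_bound[OF \<open>0 < \<theta> / 2\<close> \<open>\<theta> / 2 < \<theta>\<close> \<open>\<theta> < 1\<close> \<open>0 < q\<close>]
    by (elim exE conjE)
  have pos: "0 < p x" for x using \<open>p \<in> exponents\<close> by (simp add: exponents_def)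
  have L_eq: "?L f = Lq_star q (\<lambda>s. ennreal s * enn_powr (superlevel_norm p f s) (1 - \<theta>))" for f
    unfolding lorentz_norm_eq_Lq_star superlevel_norm_def
    by (simp only: Lp_norm_indicator_dilate[OF \<open>\<theta> < 1\<close> pos assms(7)])
  have D_meas: "superlevel_norm p f \<in> borel_measurable borel" for f
    by (intro borel_measurable_antimono_ennreal antimono_superlevel_norm)
  have K_meas [measurable]: "K_functional ?X L_infty f \<in> borel_measurable borel" for f
    by (intro borel_measurable_mono_ennreal mono_K_functional)

  \<comment> \<open>The one-dimensional estimates are normalised to constant \<open>1\<close> in the hypothesis on \<open>K\<close>, so they are
    applied to multiples of the K-functional.\<close>
  have lower: "?L f \<le> ennreal c * ?I f" for f
  proof -
    have "?L f \<le> Lq_star q (\<lambda>t. ennreal (t powr (- \<theta>)) * (ennreal c * K_functional ?X L_infty f t))"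
      unfolding L_eq
    proof (rule Lq_star_le_of_lower_bound)
      fix s t :: real assume "0 < s" "0 < t" "ennreal t \<le> superlevel_norm p f s"
      then show "ennreal (s * t) \<le> ennreal c * K_functional ?X L_infty f t"
        unfolding c_def by (rule K_functional_lower_bound[OF r])
    qed (use assms D_meas in auto)
    also have "\<dots> = Lq_star q (\<lambda>t. ennreal c * (ennreal (t powr (- \<theta>)) * K_functional ?X L_infty f t))"
      by (simp add: mult_ac)
    also have "\<dots> = ennreal c * ?I f"
      unfolding interp_norm_eq_Lq_star using \<open>c > 0\<close> \<open>0 < q\<close> by (intro Lq_star_cmult) auto
    finally show ?thesis .
  qed

  have upper: "?I f \<le> ennreal (A * B) * ?L f" if f: "f \<in> borel_measurable lebesgue" for f
  proof -
    let ?K = "\<lambda>t. ennreal (1 / A) * K_functional ?X L_infty f t"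
    have AA: "ennreal A * (ennreal (1 / A) * x) = x" "ennreal (1 / A) * (ennreal A * x) = x" for x
      using \<open>0 < A\<close> by (simp_all flip: mult.assoc ennreal_mult)
    have "?I f = Lq_star q (\<lambda>t. ennreal A * (ennreal (t powr (- \<theta>)) * ?K t))"
      unfolding interp_norm_eq_Lq_star by (simp only: AA mult.left_commute[of "ennreal A"])
    also have "\<dots> = ennreal A * Lq_star q (\<lambda>t. ennreal (t powr (- \<theta>)) * ?K t)"
      using \<open>0 < A\<close> \<open>0 < q\<close> by (intro Lq_star_cmult) auto
    also have "Lq_star q (\<lambda>t. ennreal (t powr (- \<theta>)) * ?K t) \<le> ennreal B * ?L f"
      unfolding L_eq
    proof (rule B[rule_format, OF antimono_superlevel_norm])
      fix t :: real and m
      assume "0 < t"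
        and "\<And>s. 0 < s \<Longrightarrow> ennreal s * enn_powr (min (superlevel_norm p f s) (ennreal t)) (1 - \<theta> / 2) \<le> m"
      then have "?K t \<le> ennreal (1 / A) * (ennreal A * (ennreal (t powr (\<theta> / 2)) * m))"
        by (intro mult_left_mono A[rule_format] f) auto
      then show "?K t \<le> ennreal (t powr (\<theta> / 2)) * m" by (simp only: AA)
    qed measurable
    finally show ?thesis
      using \<open>0 < A\<close> \<open>0 < B\<close> by (simp add: ennreal_mult mult.assoc mult_left_mono)
  qed

  \<comment> \<open>A finite interpolation norm yields some \<open>t\<close> with finite K-functional, hence a decomposition.\<close>
  have in_sum: "f \<in> sum_space ?X L_infty" if f: "f \<in> borel_measurable lebesgue" and "?L f < \<infinity>" for f
  proof -
    have "?I f < \<infinity>"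
      using le_less_trans[OF upper[OF f]] that by (simp add: ennreal_mult_less_top)
    then obtain t where "0 < t" "ennreal (t powr (- \<theta>)) * K_functional ?X L_infty f t < \<infinity>"
      using Lq_star_finite_imp_ex_finite[OF _ \<open>0 < q\<close>] unfolding interp_norm_eq_Lq_star by blast
    then have "K_functional ?X L_infty f t < \<infinity>"
      by (auto simp: ennreal_mult_less_top)
    then show ?thesis using f sum_space_of_K_functional_finite by blast
  qed

  have "f \<in> fst (real_interpolation ?X L_infty \<theta> q) \<longleftrightarrow> f \<in> fst (lorentz pt q)" for f
    using le_less_trans[OF lower[of f]] le_less_trans[OF upper[of f]] in_sum[of f]
    by (auto simp: real_interpolation_def lorentz_def space_of_norm_def ennreal_mult_less_top
        sum_space_def)
  moreover have "?I f \<le> ennreal (c + A * B) * ?L f" "?L f \<le> ennreal (c + A * B) * ?I f"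
    if "f \<in> borel_measurable lebesgue" for f
    using upper[OF that] lower[of f] \<open>0 < c\<close> \<open>0 < A\<close> \<open>0 < B\<close>
    by (auto elim!: order_trans intro!: mult_right_mono ennreal_leI)
  ultimately show ?thesis
    unfolding equal_equiv_norms_def using \<open>0 < c\<close> \<open>0 < A\<close> \<open>0 < B\<close>
    by (intro conjI exI[of _ "c + A * B"])
       (auto simp: real_interpolation_def lorentz_def space_of_norm_def sum_space_def add_pos_pos)
qed

end
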